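(* Let $d,N\in\mathbb{N}$, $0<\lambda<1$, $\epsilon\ge0$, and consider the adversarial pretraining problem $$\min_{\bm P,\bm Q\in[0,1]^{(d+1)\times(d+1)}}\ \mathbb{E}_{c\sim U([d]),\,\{(\bm x_n,y_n)\}_{n=1}^{N+1}\overset{\text{i.i.d.}}{\sim}\mathcal{D}^{\rm tr}_c}\Big[\max_{\|\bm\Delta\|_\infty\le\epsilon}-y_{N+1}[f(\bm Z;\bm P,\bm Q)]_{d+1,N+1}\Big].$$ Then a global minimizer is: (1) if $0\le\epsilon\le\frac{\lambda(\lambda(d-2)+4)}{2(\lambda(d-1)+2)}$: $\bm P=\bm P^{\rm std}:=\begin{bmatrix}\bm 0_{d,d+1}\\ \bm 1_{d+1}^\top\end{bmatrix}$ and $\bm Q=\bm Q^{\rm std}:=\begin{bmatrix}\bm 1_{d+1,d}&\bm 0_{d+1}\end{bmatrix}$; (2) if $\epsilon=\frac{1+(d-1)(\lambda/2)}{d}$: $\bm P=\bm P^{\rm adv}:=\begin{bmatrix}\bm 0_{d,d+1}\\ \bm 1_{d+1}^\top\end{bmatrix}$ and $\bm Q=\bm Q^{\rm adv}:=\begin{bmatrix}\bm I_d&\bm 0_d\\ \bm 0_d^\top&0\end{bmatrix}$; (3) if $\epsilon\ge\frac{\lambda}{2}+\frac32\,\frac{2-\lambda}{(d-1)\lambda^2+3}$: $\bm P=\bm 0_{d+1,d+1}$ and $\bm Q=\bm 0_{d+1,d+1}$.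
   Context: For $n\in\mathbb{N}$, $[n]:=\{1,\dots,n\}$. $U(\mathcal S)$ is the uniform distribution on a set $\mathcal S$. $\bm 1_{a}$, $\bm 1_{a,b}$, $\bm 0_a$, $\bm 0_{a,b}$, $\bm I_a$ denote the all-ones vector/matrix, the all-zeros vector/matrix and the identity. Training distributions: for $c\in[d]$ and $0<\lambda<1$, a sample $(\bm x,y)\sim\mathcal{D}^{\rm tr}_c$ with $\bm x\in\mathbb{R}^d$ is generated as follows: $y\sim U(\{\pm1\})$, $x_c=y$, and for each $i\ne c$, $x_i\sim U([0,\lambda])$ if $y=1$ and $x_i\sim U([-\lambda,0])$ if $y=-1$; given $y$, the coordinates $x_i$ are mutually independent. Transformer: given demonstrations $(\bm x_1,y_1),\dots,(\bm x_N,y_N)$, a query $\bm x_{N+1}\in\mathbb{R}^d$ and a perturbation $\bm\Delta\in\mathbb{R}^d$, let $\bm Z\in\mathbb{R}^{(d+1)\times(N+1)}$ be the matrix whose $n$-th column is $(\bm x_n^\top, y_n)^\top$ for $n\le N$ and whose last column is $((\bm x_{N+1}+\bm\Delta)^\top,0)^\top$. Let $\bm M:=\begin{bmatrix}\bm I_N&0\\0&0\end{bmatrix}\in\mathbb{R}^{(N+1)\times(N+1)}$ and, for $\bm P,\bm Q\in\mathbb{R}^{(d+1)\times(d+1)}$, $f(\bm Z;\bm P,\bm Q):=\frac1N\bm P\bm Z\bm M\bm Z^\top\bm Q\bm Z$. $[\cdot]_{d+1,N+1}$ denotes the $(d+1,N+1)$ entry. *)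

theory Defs
  imports "HOL-Probability.Probability" "Jordan_Normal_Form.Matrix"
begin

text \<open>Conventions: all indices are 0-based (matching Jordan_Normal_Form).
  Feature coordinates are 0..d-1 (the label occupies row d of Z), the
  demonstrations are samples 0..N-1 and the query is sample N.
  A sample is a pair (x, y) with x :: nat => real (only coordinates < d matter).\<close>

definition Dtr :: "nat \<Rightarrow> real \<Rightarrow> nat \<Rightarrow> ((nat \<Rightarrow> real) \<times> real) measure" where
  "Dtr d lam c =
     measure_pmf (pmf_of_set {-1, 1::real}) \<bind>
       (\<lambda>y. distr
              (PiM {..<d} (\<lambda>i. if i = c then return borel y
                                 else if y = 1 then uniform_measure lborel {0..lam}
                                 else uniform_measure lborel {-lam..0}))
              (PiM {..<d} (\<lambda>_. borel) \<Otimes>\<^sub>M borel)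
              (\<lambda>x. (x, y)))"

definition Zmat :: "nat \<Rightarrow> nat \<Rightarrow> (nat \<Rightarrow> (nat \<Rightarrow> real) \<times> real) \<Rightarrow> real vec \<Rightarrow> real mat" where
  "Zmat d N S \<Delta> = mat (d+1) (N+1) (\<lambda>(i, n).
     if n < N then (if i < d then fst (S n) i else snd (S n))
     else (if i < d then fst (S N) i + \<Delta> $ i else 0))"

definition Mmask :: "nat \<Rightarrow> real mat" where
  "Mmask N = mat (N+1) (N+1) (\<lambda>(i, j). if i = j \<and> i < N then 1 else 0)"

definition tf :: "nat \<Rightarrow> real mat \<Rightarrow> real mat \<Rightarrow> real mat \<Rightarrow> real mat" where
  "tf N P Q Z = (1 / real N) \<cdot>\<^sub>m (P * Z * Mmask N * transpose_mat Z * Q * Z)"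

definition adv_loss :: "nat \<Rightarrow> nat \<Rightarrow> real \<Rightarrow> real mat \<Rightarrow> real mat
                         \<Rightarrow> (nat \<Rightarrow> (nat \<Rightarrow> real) \<times> real) \<Rightarrow> real" where
  "adv_loss d N eps P Q S =
     (SUP \<Delta> \<in> {\<Delta> :: real vec. dim_vec \<Delta> = d \<and> (\<forall>i<d. \<bar>\<Delta> $ i\<bar> \<le> eps)}.
        - snd (S N) * (tf N P Q (Zmat d N S \<Delta>)) $$ (d, N))"

definition adv_risk :: "nat \<Rightarrow> nat \<Rightarrow> real \<Rightarrow> real \<Rightarrow> real mat \<Rightarrow> real mat \<Rightarrow> real" where
  "adv_risk d N lam eps P Q =
     (1 / real d) * (\<Sum>c<d. \<integral>S. adv_loss d N eps P Q S \<partial>(PiM {..N} (\<lambda>_. Dtr d lam c)))"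

definition admissible :: "nat \<Rightarrow> real mat \<Rightarrow> bool" where
  "admissible d P \<longleftrightarrow> P \<in> carrier_mat (d+1) (d+1) \<and>
     (\<forall>i<d+1. \<forall>j<d+1. 0 \<le> P $$ (i, j) \<and> P $$ (i, j) \<le> 1)"

definition is_global_minimizer :: "nat \<Rightarrow> nat \<Rightarrow> real \<Rightarrow> real \<Rightarrow> real mat \<Rightarrow> real mat \<Rightarrow> bool" where
  "is_global_minimizer d N lam eps P Q \<longleftrightarrow>
     admissible d P \<and> admissible d Q \<and>
     (\<forall>P' Q'. admissible d P' \<longrightarrow> admissible d Q' \<longrightarrow>
        adv_risk d N lam eps P Q \<le> adv_risk d N lam eps P' Q')"

definition P_std :: "nat \<Rightarrow> real mat" where
  "P_std d = mat (d+1) (d+1) (\<lambda>(i, j). if i = d then 1 else 0)"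

definition Q_std :: "nat \<Rightarrow> real mat" where
  "Q_std d = mat (d+1) (d+1) (\<lambda>(i, j). if j < d then 1 else 0)"

definition P_adv :: "nat \<Rightarrow> real mat" where
  "P_adv d = mat (d+1) (d+1) (\<lambda>(i, j). if i = d then 1 else 0)"

definition Q_adv :: "nat \<Rightarrow> real mat" where
  "Q_adv d = mat (d+1) (d+1) (\<lambda>(i, j). if i = j \<and> i < d then 1 else 0)"

end

(* Every entry of a training column is its label times a nonnegative number, so the second moment
   matrix of the demonstrations is entrywise nonnegative and, for P, Q with nonnegative entries, so
   are the coefficients of the linear form in the query. Almost surely the worst perturbation
   therefore shifts every coordinate by -y * eps, and the risk is
     -(1/d) * (SUM j k l. P(d,k) * Q(l,j) * A j k l),
   where A j k l = (SUM c. E_c[u_k u_l] * (E_c[u_j] - eps)) with u = y * (x, y).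
   In case (3) all A j k l are nonpositive. In case (1) the rows and columns k in {j, d} of A j are
   nonnegative and outweigh the negative entries of every other row, so for each j separately the
   bilinear form is maximal at the all-ones vectors. Case (2) cannot be treated for each j separately:
   the gain of switching off some features for one j is paid for by the loss in the terms j' = k. *)

theory Submission
  imports Defs
begin

subsection \<open>The training distribution\<close>

text \<open>Each threshold is the zero of one coefficient: of \<open>A j d k\<close> with
  \<open>k\<close> outside \<open>{j, d}\<close> in case (1), of \<open>A j d d\<close> in case (2),
  of \<open>A j j j\<close> in case (3). The obstacle in case (2) is that row \<open>d\<close> of
  \<open>P\<close> is shared by all \<open>j\<close>, while column \<open>j\<close> of
  \<open>Q\<close> can be chosen for each \<open>j\<close> on its own. In cases (1) and (3) one row
  serves every \<open>j\<close>. In case (2) a single \<open>j\<close> may prefer a row that is 1 at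
  \<open>j\<close> and \<open>d\<close> and 0 elsewhere: already for \<open>d = 2\<close> this row,
  with \<open>Q\<close> equal to 1 at \<open>(j, j)\<close> and \<open>(d, j)\<close>, beats what
  the all-ones row and \<open>Q_adv\<close> yield for that \<open>j\<close>. Such a row, however,
  deprives every other index \<open>k\<close> of its main entry \<open>A k k k\<close>. The bounds
  for the single \<open>j\<close> therefore have to keep their dependence on the row, and only their
  sum over \<open>j\<close> is compared with the claimed optimum.\<close>

lemma uniform_measure_Icc_moment:
  fixes a b :: real
  assumes "a < b"
  shows "integrable (uniform_measure lborel {a..b}) (\<lambda>x. x ^ k)"
    and "(\<integral>x. x ^ k \<partial>uniform_measure lborel {a..b}) = (b ^ Suc k - a ^ Suc k) / (real (Suc k) * (b - a))"
proof -
  let ?d = "\<lambda>x. indicator {a..b} x / (b - a)"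
  have e: "uniform_measure lborel {a..b} = density lborel (\<lambda>x. ennreal (?d x))"
    unfolding uniform_measure_def using assms
    by (intro arg_cong[where f = "density lborel"] ext)
       (auto simp: indicator_def divide_ennreal simp flip: ennreal_1)
  have i: "integrable lborel (\<lambda>x. x ^ k * indicator {a..b} x :: real)"
    using borel_integrable_atLeastAtMost'[of a b "\<lambda>x. x ^ k"]
    by (simp add: set_integrable_def mult.commute continuous_on_power)
  have "integrable lborel (\<lambda>x. (x ^ k * indicator {a..b} x) * (1 / (b - a)) :: real)"
    using i by (intro integrable_mult_left) auto
  then show "integrable (uniform_measure lborel {a..b}) (\<lambda>x. x ^ k)"
    unfolding e using assms by (subst integrable_density) (auto simp: mult_ac)
  have "(\<integral>x. x ^ k \<partial>uniform_measure lborel {a..b}) = (\<integral>x. (x ^ k * indicator {a..b} x) * (1 / (b - a)) \<partial>lborel)"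
    unfolding e using assms by (subst integral_density) (auto simp: mult_ac)
  also have "\<dots> = (\<integral>x. (x ^ k * indicator {a..b} x) \<partial>lborel) * (1 / (b - a))"
    by (rule integral_mult_left_zero)
  also have "\<dots> = (b ^ Suc k - a ^ Suc k) / (real (Suc k) * (b - a))"
    using assms by (subst integral_power) (auto simp: field_simps)
  finally show "(\<integral>x. x ^ k \<partial>uniform_measure lborel {a..b}) = (b ^ Suc k - a ^ Suc k) / (real (Suc k) * (b - a))" .
qed

text \<open>Total in \<open>i\<close>: indices \<open>i >= d\<close> get a probability law too,
  since \<open>has_bochner_integral_PiM_prod\<close> asks for \<open>prob_space\<close> at every
  index. A label other than \<open>1\<close> falls into the negative branch, so the moment lemmas
  restrict \<open>y\<close> to \<open>{-1, 1}\<close>.\<close>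

definition coord_law :: "real \<Rightarrow> nat \<Rightarrow> real \<Rightarrow> nat \<Rightarrow> real measure" where
  "coord_law lam c y i = (if i = c then return borel y
     else if y = 1 then uniform_measure lborel {0..lam} else uniform_measure lborel {-lam..0})"

definition label_law :: "nat \<Rightarrow> real \<Rightarrow> nat \<Rightarrow> real \<Rightarrow> ((nat \<Rightarrow> real) \<times> real) measure" where
  "label_law d lam c y =
     distr (PiM {..<d} (coord_law lam c y)) (PiM {..<d} (\<lambda>_. borel) \<Otimes>\<^sub>M borel) (\<lambda>x. (x, y))"

abbreviation sample_space :: "nat \<Rightarrow> ((nat \<Rightarrow> real) \<times> real) measure" where
  "sample_space d \<equiv> PiM {..<d} (\<lambda>_. borel) \<Otimes>\<^sub>M borel"

lemma Dtr_eq: "Dtr d lam c = measure_pmf (pmf_of_set {-1, 1}) \<bind> label_law d lam c"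
  unfolding Dtr_def label_law_def coord_law_def ..

lemma sets_coord_law [measurable_cong, simp]: "sets (coord_law lam c y i) = sets borel"
  by (simp add: coord_law_def)

lemma prob_space_coord_law: "0 < lam \<Longrightarrow> prob_space (coord_law lam c y i)"
  unfolding coord_law_def
  by (auto intro!: prob_space_return prob_space_uniform_measure)

lemma sets_PiM_coord_law [measurable_cong]:
  "sets (PiM I (coord_law lam c y)) = sets (PiM I (\<lambda>_. borel))"
  by (rule sets_PiM_cong) auto

lemma prob_space_label_law:
  assumes "0 < lam" shows "prob_space (label_law d lam c y)"
  unfolding label_law_def
  by (intro prob_space.prob_space_distr prob_space_PiM prob_space_coord_law assms) measurable

lemma sets_label_law [measurable_cong, simp]: "sets (label_law d lam c y) = sets (sample_space d)"
  by (simp add: label_law_def)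

lemma measurable_label_law:
  assumes "0 < lam"
  shows "label_law d lam c \<in> measure_pmf p \<rightarrow>\<^sub>M subprob_algebra (sample_space d)"
  using prob_space_label_law[OF assms]
  by (auto simp: space_subprob_algebra prob_space_imp_subprob_space)

lemma sets_Dtr [measurable_cong, simp]: "sets (Dtr d lam c) = sets (sample_space d)"
  unfolding Dtr_eq by (subst sets_bind[where N = "sample_space d"]) auto

lemma prob_space_Dtr: "0 < lam \<Longrightarrow> prob_space (Dtr d lam c)"
  unfolding Dtr_eq
  by (rule prob_space.prob_space_bind[OF _ _ measurable_label_law])
     (auto intro: prob_space_label_law prob_space_measure_pmf)

text \<open>For nonnegative functions the integral over a \<open>bind\<close> is an iterated
  \<open>nn_integral\<close>, which here is the mean of the two conditional integrals
  (\<open>pos\<close>). A general \<open>f\<close> is split into positive and negative part. The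
  \<open>has_bochner_integral\<close> form delivers integrability together with the value.\<close>

lemma has_bochner_integral_Dtr:
  fixes f :: "(nat \<Rightarrow> real) \<times> real \<Rightarrow> real"
  assumes lam: "0 < lam"
    and f: "\<And>y. y \<in> {-1, 1} \<Longrightarrow> has_bochner_integral (label_law d lam c y) f (I y)"
  shows "has_bochner_integral (Dtr d lam c) f ((I (-1) + I 1) / 2)"
proof -
  have [measurable]: "f \<in> borel_measurable (sample_space d)"
    using borel_measurable_has_bochner_integral[OF f[of 1]] by simp
  have half: "ennreal a * inverse 2 + ennreal b * inverse 2 = ennreal ((a + b) / 2)"
    if "0 \<le> a" "0 \<le> b" for a b
  proof -
    have h: "inverse 2 = ennreal (1 / 2)"
      using inverse_ennreal[of 2] by simp
    have "ennreal x * inverse 2 = ennreal (x / 2)" if "0 \<le> x" for x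
      unfolding h using that by (subst ennreal_mult[symmetric]) auto
    then show ?thesis
      using that by (simp add: add_divide_distrib)
  qed
  have pos: "has_bochner_integral (Dtr d lam c) g ((J (-1) + J 1) / 2)"
    if [measurable]: "g \<in> borel_measurable (sample_space d)" and g0: "\<And>w. 0 \<le> g w"
      and g: "\<And>y. y \<in> {-1, 1} \<Longrightarrow> has_bochner_integral (label_law d lam c y) g (J y)"
    for g :: "(nat \<Rightarrow> real) \<times> real \<Rightarrow> real" and J
  proof (rule has_bochner_integral_nn_integral)
    have J0: "0 \<le> J y" if "y \<in> {-1, 1}" for y
    proof -
      have "0 \<le> integral\<^sup>L (label_law d lam c y) g"
        using g0 by (intro Bochner_Integration.integral_nonneg) auto
      then show ?thesis using g[OF that] by (simp add: has_bochner_integral_iff)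
    qed
    have nn: "(\<integral>\<^sup>+w. ennreal (g w) \<partial>label_law d lam c y) = ennreal (J y)" if "y \<in> {-1, 1}" for y
      using g[OF that] g0 by (simp add: has_bochner_integral_iff nn_integral_eq_integral)
    show "(\<integral>\<^sup>+w. ennreal (g w) \<partial>Dtr d lam c) = ennreal ((J (-1) + J 1) / 2)"
      unfolding Dtr_eq
      apply (subst nn_integral_bind[OF _ measurable_label_law[OF lam]])
       apply simp
      apply (subst nn_integral_measure_pmf_finite)
       apply (simp_all add: nn half J0)
      done
    show "0 \<le> (J (-1) + J 1) / 2" using J0[of 1] J0[of "-1"] by simp
  qed (use g0 in simp_all)
  let ?p = "\<lambda>w. max 0 (f w)" and ?n = "\<lambda>w. max 0 (- f w)"
  let ?Ip = "\<lambda>y. \<integral>w. ?p w \<partial>label_law d lam c y" and ?In = "\<lambda>y. \<integral>w. ?n w \<partial>label_law d lam c y"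
  have P: "has_bochner_integral (label_law d lam c y) ?p (?Ip y)"
    and Q: "has_bochner_integral (label_law d lam c y) ?n (?In y)" if "y \<in> {-1, 1}" for y
    using f[OF that] by (auto simp: has_bochner_integral_iff)
  have split: "f = (\<lambda>w. ?p w - ?n w)" by (auto simp: max_def)
  have I: "I y = ?Ip y - ?In y" if "y \<in> {-1, 1}" for y
    using has_bochner_integral_diff[OF P[OF that] Q[OF that]] f[OF that]
    by (subst (asm) split[symmetric]) (rule has_bochner_integral_eq)
  have "has_bochner_integral (Dtr d lam c) (\<lambda>w. ?p w - ?n w)
      ((?Ip (-1) + ?Ip 1) / 2 - (?In (-1) + ?In 1) / 2)"
    using P Q by (intro has_bochner_integral_diff pos) simp_all
  moreover have "(?Ip (-1) + ?Ip 1) / 2 - (?In (-1) + ?In 1) / 2 = (I (-1) + I 1) / 2"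
    using I[of 1] I[of "-1"] by (simp add: field_simps)
  ultimately show ?thesis
    unfolding split[symmetric] by (simp only:)
qed

lemma AE_Dtr:
  assumes "0 < lam" "Measurable.pred (sample_space d) R"
    and "\<And>y. y \<in> {-1, 1} \<Longrightarrow> AE w in label_law d lam c y. R w"
  shows "AE w in Dtr d lam c. R w"
  unfolding Dtr_eq
  by (subst AE_bind[OF measurable_label_law[OF assms(1)] assms(2)])
     (auto simp: AE_measure_pmf_iff assms(3))

lemma AE_coord_law:
  assumes "0 < lam" "y \<in> {-1, 1}"
  shows "AE x in coord_law lam c y i. 0 \<le> y * x"
proof -
  have *: "AE x in uniform_measure lborel S. x \<in> S" if "S \<in> sets borel" for S :: "real set"
    using that by (intro AE_uniform_measureI) auto
  have "AE x in uniform_measure lborel {0..lam}. 0 \<le> x"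
    and "AE x in uniform_measure lborel {-lam..0}. x \<le> 0"
    using *[of "{0..lam}"] *[of "{-lam..0}"] by auto
  with assms(2) show ?thesis
    unfolding coord_law_def by (cases "i = c") (auto simp: AE_return)
qed

section \<open>Columns of the prompt and their moments\<close>

text \<open>Treats the label as one more coordinate, with index \<open>d\<close>, so that the
  moments of a whole column of \<open>Z\<close> are handled uniformly.\<close>

definition entry :: "nat \<Rightarrow> (nat \<Rightarrow> real) \<times> real \<Rightarrow> nat \<Rightarrow> real" where
  "entry d w k = (if k < d then fst w k else snd w)"

lemma measurable_entry [measurable]: "(\<lambda>w. entry d w k) \<in> borel_measurable (sample_space d)"
proof (cases "k < d")
  case True
  then have [measurable]: "k \<in> {..<d}" by simp
  show ?thesis using True unfolding entry_def by simp
qed (simp add: entry_def)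

lemma AE_Dtr_entry:
  assumes "0 < lam"
  shows "AE w in Dtr d lam c. snd w \<in> {-1, 1} \<and> 0 \<le> snd w * entry d w k"
proof (rule AE_Dtr[OF assms])
  have [measurable]: "Measurable.pred (sample_space d) (\<lambda>w. snd w \<in> {-1, 1})"
    by (rule pred_sets2[where N = borel]) auto
  show P: "Measurable.pred (sample_space d) (\<lambda>w. snd w \<in> {-1, 1} \<and> 0 \<le> snd w * entry d w k)"
    by measurable
  fix y :: real assume y: "y \<in> {-1, 1}"
  have "AE x in PiM {..<d} (coord_law lam c y). k < d \<longrightarrow> 0 \<le> y * x k"
  proof (cases "k < d")
    case True
    then have "AE x in PiM {..<d} (coord_law lam c y). 0 \<le> y * x k"
      using assms y by (intro AE_PiM_component AE_coord_law prob_space_coord_law) auto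
    then show ?thesis by simp
  qed simp
  then have "AE x in PiM {..<d} (coord_law lam c y).
      snd (x, y) \<in> {-1, 1} \<and> 0 \<le> snd (x, y) * entry d (x, y) k"
    by (rule eventually_mono) (use y in \<open>auto simp: entry_def\<close>)
  then show "AE w in label_law d lam c y. snd w \<in> {-1, 1} \<and> 0 \<le> snd w * entry d w k"
    unfolding label_law_def using P by (subst AE_distr_iff) auto
qed

text \<open>The mean of \<open>y\<close> times coordinate \<open>k\<close>. The factor
  \<open>y\<close> removes the dependence on the label; at the target \<open>c\<close> and at the
  label \<open>d\<close> the product is \<open>y * y = 1\<close>.\<close>

definition first_moment :: "nat \<Rightarrow> real \<Rightarrow> nat \<Rightarrow> nat \<Rightarrow> real" where
  "first_moment d lam c k = (if k = c \<or> k = d then 1 else lam / 2)"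

definition second_moment :: "nat \<Rightarrow> real \<Rightarrow> nat \<Rightarrow> nat \<Rightarrow> real" where
  "second_moment d lam c k = (if k = c \<or> k = d then 1 else lam\<^sup>2 / 3)"

text \<open>The mean of \<open>entry k * entry l\<close>. As \<open>y * y = 1\<close>, both entries
  may be multiplied by \<open>y\<close>, and the signed coordinates are independent given
  \<open>y\<close>: off the diagonal the means multiply.\<close>

definition cross_moment :: "nat \<Rightarrow> real \<Rightarrow> nat \<Rightarrow> nat \<Rightarrow> nat \<Rightarrow> real" where
  "cross_moment d lam c k l =
     (if k = l then second_moment d lam c k else first_moment d lam c k * first_moment d lam c l)"

lemma has_bochner_integral_return:
  fixes f :: "real \<Rightarrow> real"
  assumes "f \<in> borel_measurable borel"
  shows "has_bochner_integral (return borel y) f (f y)"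
proof -
  have "integrable (return borel y) f"
    using assms by (intro integrableI_bounded) (auto simp: nn_integral_return)
  then show ?thesis using assms by (simp add: has_bochner_integral_iff integral_return)
qed

lemma has_bochner_integral_coord_law:
  assumes "0 < lam" "y \<in> {-1, 1}" "i < d"
  shows "has_bochner_integral (coord_law lam c y i) (\<lambda>x. x) (y * first_moment d lam c i)"
    and "has_bochner_integral (coord_law lam c y i) (\<lambda>x. x\<^sup>2) (second_moment d lam c i)"
proof -
  have U: "has_bochner_integral (uniform_measure lborel {0..lam}) (\<lambda>x. x) (lam / 2)"
    "has_bochner_integral (uniform_measure lborel {0..lam}) (\<lambda>x. x\<^sup>2) (lam\<^sup>2 / 3)"
    "has_bochner_integral (uniform_measure lborel {-lam..0}) (\<lambda>x. x) (- (lam / 2))"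
    "has_bochner_integral (uniform_measure lborel {-lam..0}) (\<lambda>x. x\<^sup>2) (lam\<^sup>2 / 3)"
    using uniform_measure_Icc_moment[of 0 lam 1] uniform_measure_Icc_moment[of 0 lam 2]
      uniform_measure_Icc_moment[of "-lam" 0 1] uniform_measure_Icc_moment[of "-lam" 0 2] assms(1)
    by (simp_all add: has_bochner_integral_iff power2_eq_square power3_eq_cube)
  have "i \<noteq> d" using assms(3) by simp
  have law: "coord_law lam c y i = (if i = c then return borel y
      else if y = 1 then uniform_measure lborel {0..lam} else uniform_measure lborel {-lam..0})"
    by (rule coord_law_def)
  consider (target) "i = c" | (pos) "i \<noteq> c" "y = 1" | (neg) "i \<noteq> c" "y = -1"
    using assms(2) by blast
  note cases = this
  show "has_bochner_integral (coord_law lam c y i) (\<lambda>x. x) (y * first_moment d lam c i)"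
  proof (cases rule: cases)
    case target
    have "y * first_moment d lam c i = y" using target by (simp add: first_moment_def)
    then show ?thesis unfolding law if_P[OF target]
      by (simp only:) (rule has_bochner_integral_return, measurable)
  next
    case pos
    have "y * first_moment d lam c i = lam / 2"
      using pos \<open>i \<noteq> d\<close> by (simp add: first_moment_def)
    then show ?thesis unfolding law if_not_P[OF pos(1)] if_P[OF pos(2)]
      by (simp only:) (rule U)
  next
    case neg
    have "y * first_moment d lam c i = - (lam / 2)" "y \<noteq> 1"
      using neg \<open>i \<noteq> d\<close> by (simp_all add: first_moment_def)
    then show ?thesis unfolding law if_not_P[OF neg(1)] if_not_P[OF \<open>y \<noteq> 1\<close>]
      by (simp only:) (rule U)
  qed
  show "has_bochner_integral (coord_law lam c y i) (\<lambda>x. x\<^sup>2) (second_moment d lam c i)"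
  proof (cases rule: cases)
    case target
    have "y\<^sup>2 = 1" using assms(2) by auto
    then have "second_moment d lam c i = y\<^sup>2" using target by (simp add: second_moment_def)
    then show ?thesis unfolding law if_P[OF target]
      by (simp only:) (rule has_bochner_integral_return, measurable)
  next
    case pos
    have "second_moment d lam c i = lam\<^sup>2 / 3"
      using pos \<open>i \<noteq> d\<close> by (simp add: second_moment_def)
    then show ?thesis unfolding law if_not_P[OF pos(1)] if_P[OF pos(2)]
      by (simp only:) (rule U)
  next
    case neg
    have "second_moment d lam c i = lam\<^sup>2 / 3" "y \<noteq> 1"
      using neg \<open>i \<noteq> d\<close> by (simp_all add: second_moment_def)
    then show ?thesis unfolding law if_not_P[OF neg(1)] if_not_P[OF \<open>y \<noteq> 1\<close>]
      by (simp only:) (rule U)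
  qed
qed

lemma (in prob_space) has_bochner_integral_const:
  "has_bochner_integral M (\<lambda>_. a) (a :: real)"
  by (simp add: has_bochner_integral_iff prob_space)

lemma has_bochner_integral_PiM_prod:
  fixes f :: "'i \<Rightarrow> 'a \<Rightarrow> real"
  assumes "finite I" "\<And>i. prob_space (M i)"
    and "\<And>i. i \<in> I \<Longrightarrow> has_bochner_integral (M i) (f i) (v i)"
  shows "has_bochner_integral (PiM I M) (\<lambda>x. \<Prod>i\<in>I. f i (x i)) (\<Prod>i\<in>I. v i)"
proof -
  interpret product_sigma_finite M
    using assms(2) by (auto simp: product_sigma_finite_def intro: prob_space_imp_sigma_finite)
  show ?thesis
    using assms(1,3) product_integrable_prod[of I f] product_integral_prod[of I f]
    by (simp add: has_bochner_integral_iff)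
qed

text \<open>The two entries are written as a product over all coordinates with factor 1 elsewhere,
  so that independence applies. An index equal to \<open>d\<close> meets no coordinate; its factor
  is the constant \<open>?y\<close>. For distinct indices the label occurs twice in the result and
  cancels, whence the value is the same for both labels.\<close>

lemma has_bochner_integral_label_law:
  assumes "0 < lam" "y \<in> {-1, 1}" "c < d" "k \<le> d" "l \<le> d"
  shows "has_bochner_integral (label_law d lam c y) (\<lambda>w. entry d w k * entry d w l)
    (cross_moment d lam c k l)"
proof -
  let ?y = "\<lambda>k. if k = d then y else 1"
  let ?f = "\<lambda>i x. (if i = k then x else 1) * (if i = l then x else 1) :: real"
  let ?v = "\<lambda>i. if i = k then (if i = l then second_moment d lam c i else y * first_moment d lam c i)
     else if i = l then y * first_moment d lam c i else 1"
  have "has_bochner_integral (PiM {..<d} (coord_law lam c y))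
      (\<lambda>x. (\<Prod>i<d. ?f i (x i)) * (?y k * ?y l)) ((\<Prod>i<d. ?v i) * (?y k * ?y l))"
  proof (rule has_bochner_integral_mult_left, rule has_bochner_integral_PiM_prod)
    fix i assume "i \<in> {..<d}"
    moreover have "has_bochner_integral (coord_law lam c y i) (\<lambda>x. 1 :: real) 1"
    by (rule prob_space.has_bochner_integral_const[OF prob_space_coord_law[OF assms(1)]])
    ultimately show "has_bochner_integral (coord_law lam c y i) (?f i) (?v i)"
      using has_bochner_integral_coord_law[OF assms(1,2)] by (auto simp: power2_eq_square)
  qed (use assms prob_space_coord_law in auto)
  moreover have "(\<Prod>i<d. ?f i (x i)) * (?y k * ?y l) = entry d (x, y) k * entry d (x, y) l" for x
    using assms(4,5) by (auto simp: prod.distrib entry_def)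
  moreover have "(\<Prod>i<d. ?v i) * (?y k * ?y l) = cross_moment d lam c k l"
  proof (cases "k = l")
    case True
    have "(\<Prod>i<d. ?v i) = (\<Prod>i<d. if i = k then second_moment d lam c i else 1)"
      using True by (intro prod.cong) auto
    then show ?thesis
      using True assms(2-4) by (auto simp: cross_moment_def second_moment_def)
  next
    case False
    then have "(\<Prod>i<d. ?v i) = (\<Prod>i<d. (if i = k then y * first_moment d lam c i else 1) *
        (if i = l then y * first_moment d lam c i else 1))"
      by (intro prod.cong) auto
    then show ?thesis
      using False assms(2-5) by (auto simp: prod.distrib cross_moment_def first_moment_def)
  qed
  ultimately show ?thesis
    unfolding label_law_def
    by (simp add: has_bochner_integral_iff integrable_distr_eq integral_distr)
qed

lemma has_bochner_integral_Dtr_entry: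
  assumes "0 < lam" "c < d" "k \<le> d" "l \<le> d"
  shows "has_bochner_integral (Dtr d lam c) (\<lambda>w. entry d w k * entry d w l) (cross_moment d lam c k l)"
  using has_bochner_integral_Dtr[OF assms(1) has_bochner_integral_label_law[OF assms(1) _ assms(2-4)]]
  by simp

subsection \<open>The adversarial risk as a bilinear form\<close>

text \<open>The coefficient of the perturbed query coordinate \<open>j\<close> in the prediction.
  Only row \<open>d\<close> of \<open>P\<close> occurs, because only that row of the output is
  read.\<close>

definition weight :: "nat \<Rightarrow> nat \<Rightarrow> real mat \<Rightarrow> real mat \<Rightarrow> (nat \<Rightarrow> (nat \<Rightarrow> real) \<times> real) \<Rightarrow> nat \<Rightarrow> real" where
  "weight d N P Q S j = (\<Sum>k\<le>d. \<Sum>l\<le>d. \<Sum>n<N.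
     P $$ (d, k) * Q $$ (l, j) * (1 / real N) * (entry d (S n) k * entry d (S n) l))"

lemma index_mult_mat_sum:
  assumes "A \<in> carrier_mat n m" "B \<in> carrier_mat m p" "i < n" "j < p"
  shows "(A * B) $$ (i, j) = (\<Sum>k<m. A $$ (i, k) * B $$ (k, j))"
  using assms by (auto simp: scalar_prod_def atLeast0LessThan intro!: sum.cong)

text \<open>The mask removes the query column from the second moment matrix, so the output is linear
  in the query. The zero in the label slot of the query removes column \<open>d\<close> of
  \<open>Q\<close>.\<close>

lemma tf_entry:
  assumes P: "P \<in> carrier_mat (d+1) (d+1)" and Q: "Q \<in> carrier_mat (d+1) (d+1)"
  shows "tf N P Q (Zmat d N S \<Delta>) $$ (d, N) =
    (\<Sum>j<d. weight d N P Q S j * (fst (S N) j + vec_index \<Delta> j))"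
proof -
  define Z where "Z = Zmat d N S \<Delta>"
  have Z: "Z \<in> carrier_mat (d+1) (N+1)" by (simp add: Z_def Zmat_def)
  have M: "Mmask N \<in> carrier_mat (N+1) (N+1)" by (simp add: Mmask_def)
  have Zt: "transpose_mat Z \<in> carrier_mat (N+1) (d+1)" using Z by simp
  have PZ: "P * Z \<in> carrier_mat (d+1) (N+1)" using P Z by simp
  have PZM: "P * Z * Mmask N \<in> carrier_mat (d+1) (N+1)" using PZ M by simp
  have PZMZ: "P * Z * Mmask N * transpose_mat Z \<in> carrier_mat (d+1) (d+1)" using PZM Zt by simp
  have PZMZQ: "P * Z * Mmask N * transpose_mat Z * Q \<in> carrier_mat (d+1) (d+1)" using PZMZ Q by simp
  have Zn: "Z $$ (k, n) = entry d (S n) k" if "k \<le> d" "n < N" for k n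
    using that by (simp add: Z_def Zmat_def entry_def)
  have ZN: "Z $$ (j, N) = (if j < d then fst (S N) j + vec_index \<Delta> j else 0)" if "j \<le> d" for j
    using that by (simp add: Z_def Zmat_def)
  have e1: "(P * Z * Mmask N) $$ (d, n) = (if n < N then \<Sum>k\<le>d. P $$ (d, k) * entry d (S n) k else 0)"
    if "n \<le> N" for n
  proof -
    have "(P * Z * Mmask N) $$ (d, n) = (\<Sum>m<N+1. (P * Z) $$ (d, m) * (if m = n \<and> n < N then 1 else 0))"
      using that by (subst index_mult_mat_sum[OF PZ M]) (auto simp: Mmask_def intro!: sum.cong)
    also have "\<dots> = (if n < N then (P * Z) $$ (d, n) else 0)"
      by (auto simp: if_distrib[of "\<lambda>x. _ * x"] cong: if_cong)
    also have "\<dots> = (if n < N then \<Sum>k\<le>d. P $$ (d, k) * entry d (S n) k else 0)"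
      by (auto simp: index_mult_mat_sum[OF P Z] Zn lessThan_Suc_atMost simp del: index_mult_mat
          intro!: sum.cong)
    finally show ?thesis .
  qed
  have e2: "(P * Z * Mmask N * transpose_mat Z) $$ (d, l) =
      (\<Sum>n<N. (\<Sum>k\<le>d. P $$ (d, k) * entry d (S n) k) * entry d (S n) l)" if "l \<le> d" for l
  proof -
    have "(P * Z * Mmask N * transpose_mat Z) $$ (d, l) =
        (\<Sum>n<N+1. (P * Z * Mmask N) $$ (d, n) * Z $$ (l, n))"
      using that Z by (subst index_mult_mat_sum[OF PZM Zt]) auto
    also have "\<dots> = (\<Sum>n<N. (P * Z * Mmask N) $$ (d, n) * Z $$ (l, n))"
      using e1[of N] by simp
    also have "\<dots> = (\<Sum>n<N. (\<Sum>k\<le>d. P $$ (d, k) * entry d (S n) k) * entry d (S n) l)"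
      using e1 that by (intro sum.cong) (auto simp: Zn)
    finally show ?thesis .
  qed
  \<comment> \<open>\<open>weight\<close> already contains the factor \<open>1 / real N\<close>,
    which is undone here and supplied again by the prefactor of \<open>tf\<close>. For
    \<open>N = 0\<close> both sides vanish.\<close>
  have "(P * Z * Mmask N * transpose_mat Z * Q) $$ (d, j) = real N * weight d N P Q S j" if "j < d" for j
  proof (cases "N = 0")
    case False
    have "(P * Z * Mmask N * transpose_mat Z * Q) $$ (d, j) =
        (\<Sum>l\<le>d. (\<Sum>n<N. (\<Sum>k\<le>d. P $$ (d, k) * entry d (S n) k) * entry d (S n) l) * Q $$ (l, j))"
      using that by (subst index_mult_mat_sum[OF PZMZ Q]) (auto simp: e2 lessThan_Suc_atMost intro!: sum.cong)
    also have "\<dots> = (\<Sum>l\<le>d. \<Sum>n<N. \<Sum>k\<le>d. P $$ (d, k) * Q $$ (l, j) * (entry d (S n) k * entry d (S n) l))"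
      by (simp add: sum_distrib_left sum_distrib_right mult_ac)
    also have "\<dots> = (\<Sum>l\<le>d. \<Sum>k\<le>d. \<Sum>n<N. P $$ (d, k) * Q $$ (l, j) * (entry d (S n) k * entry d (S n) l))"
      by (intro sum.cong refl sum.swap)
    also have "\<dots> = (\<Sum>k\<le>d. \<Sum>l\<le>d. \<Sum>n<N. P $$ (d, k) * Q $$ (l, j) * (entry d (S n) k * entry d (S n) l))"
      by (rule sum.swap)
    also have "\<dots> = real N * weight d N P Q S j"
      using False by (simp add: weight_def sum_distrib_left)
    finally show ?thesis .
  next
    case True
    then show ?thesis using that
      by (subst index_mult_mat_sum[OF PZMZ Q]) (auto simp: e2[unfolded True] lessThan_Suc_atMost simp del: index_mult_mat sum.lessThan_Suc)
  qed
  then have "(P * Z * Mmask N * transpose_mat Z * Q * Z) $$ (d, N) =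
      (\<Sum>j<d. real N * weight d N P Q S j * (fst (S N) j + vec_index \<Delta> j))"
    by (subst index_mult_mat_sum[OF PZMZQ Z]) (auto simp: ZN simp del: index_mult_mat)
  moreover have "P * Z * Mmask N * transpose_mat Z * Q * Z \<in> carrier_mat (d+1) (N+1)"
    using PZMZQ Z by simp
  moreover have "weight d N P Q S j = 0" if "N = 0" for j using that by (simp add: weight_def)
  ultimately show ?thesis
    unfolding tf_def Z_def[symmetric]
    by (cases "N = 0") (auto simp: sum_distrib_left simp del: index_mult_mat)
qed

section \<open>The worst perturbation and the expected loss\<close>

text \<open>The loss is affine in the perturbation and the box constraint decouples the coordinates,
  so the maximizer \<open>E\<close> takes a sign in each of them and the supremum is
  \<open>eps\<close> times the l1 norm of the coefficients.\<close>

lemma adv_loss_eq: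
  assumes P: "P \<in> carrier_mat (d+1) (d+1)" and Q: "Q \<in> carrier_mat (d+1) (d+1)" and "0 \<le> eps"
  shows "adv_loss d N eps P Q S =
    (\<Sum>j<d. eps * \<bar>snd (S N) * weight d N P Q S j\<bar> - snd (S N) * weight d N P Q S j * fst (S N) j)"
proof -
  let ?w = "\<lambda>j. snd (S N) * weight d N P Q S j"
  let ?D = "{\<Delta> :: real Matrix.vec. dim_vec \<Delta> = d \<and> (\<forall>i<d. \<bar>vec_index \<Delta> i\<bar> \<le> eps)}"
  let ?F = "\<lambda>\<Delta>. - snd (S N) * tf N P Q (Zmat d N S \<Delta>) $$ (d, N)"
  have F: "?F \<Delta> = (\<Sum>j<d. - ?w j * vec_index \<Delta> j - ?w j * fst (S N) j)" for \<Delta>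
    unfolding tf_entry[OF P Q] by (simp add: sum_distrib_left algebra_simps flip: sum_negf)
  define E where "E = Matrix.vec d (\<lambda>j. - sgn (?w j) * eps)"
  have E: "E \<in> ?D"
    using \<open>0 \<le> eps\<close> by (auto simp: E_def abs_mult sgn_real_def)
  have FE: "?F E = (\<Sum>j<d. eps * \<bar>?w j\<bar> - ?w j * fst (S N) j)"
    unfolding F by (intro sum.cong) (auto simp: E_def abs_sgn mult_ac)
  have "?F \<Delta> \<le> ?F E" if "\<Delta> \<in> ?D" for \<Delta>
    unfolding F[of \<Delta>] FE
  proof (intro sum_mono diff_right_mono)
    fix j assume "j \<in> {..<d}"
    then have "\<bar>- ?w j * vec_index \<Delta> j\<bar> \<le> \<bar>?w j\<bar> * eps"
      using that by (auto simp: abs_mult mult_left_mono)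
    then show "- ?w j * vec_index \<Delta> j \<le> eps * \<bar>?w j\<bar>" by (simp add: mult.commute)
  qed
  then have "(SUP \<Delta>\<in>?D. ?F \<Delta>) = ?F E"
    using E by (intro cSup_eq_maximum) auto
  then show ?thesis unfolding adv_loss_def FE .
qed

text \<open>Independence of two different samples, again as a product over all indices with factor 1
  elsewhere. It will be applied to a demonstration and the query.\<close>

lemma has_bochner_integral_PiM_two:
  fixes f g :: "'a \<Rightarrow> real"
  assumes "finite I" "i \<in> I" "j \<in> I" "i \<noteq> j" "prob_space M"
    and "has_bochner_integral M f a" "has_bochner_integral M g b"
  shows "has_bochner_integral (PiM I (\<lambda>_. M)) (\<lambda>S. f (S i) * g (S j)) (a * b)"
proof -
  interpret prob_space M by fact
  have "has_bochner_integral (PiM I (\<lambda>_. M))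
     (\<lambda>S. \<Prod>n\<in>I. (if n = i then f else if n = j then g else (\<lambda>_. 1)) (S n))
     (\<Prod>n\<in>I. if n = i then a else if n = j then b else 1)"
    using assms has_bochner_integral_const[of 1] by (intro has_bochner_integral_PiM_prod) auto
  moreover have "(\<Prod>n\<in>I. if n = i then p n else if n = j then q n else 1) = p i * q j"
    for p q :: "'b \<Rightarrow> real"
  proof -
    have "(\<Prod>n\<in>I. if n = i then p n else if n = j then q n else 1) =
        (\<Prod>n\<in>I. (if n = i then p n else 1) * (if n = j then q n else 1))"
      using assms(4) by (intro prod.cong) auto
    then show ?thesis using assms(1-3) by (simp add: prod.distrib)
  qed
  ultimately show ?thesis
    by (simp add: if_distrib[of "\<lambda>h. h _"] cong: if_cong)
qed

text \<open>Almost surely \<open>y * y = 1\<close>, so a product of two entries equals the product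
  of the two signed entries and is nonnegative. Hence \<open>weight\<close> is nonnegative and the
  absolute value in \<open>adv_loss_eq\<close> is \<open>weight\<close> itself. The factor
  \<open>entry d (S N) d\<close> is the label of the query.\<close>

lemma AE_adv_loss:
  assumes P: "admissible d P" and Q: "admissible d Q" and "0 \<le> eps" "0 < lam"
  shows "AE S in PiM {..N} (\<lambda>_. Dtr d lam c). adv_loss d N eps P Q S =
    (\<Sum>j<d. weight d N P Q S j * (eps - entry d (S N) d * entry d (S N) j))"
proof -
  have "AE S in PiM {..N} (\<lambda>_. Dtr d lam c). snd (S n) \<in> {-1, 1} \<and> 0 \<le> snd (S n) * entry d (S n) k"
    if "n \<le> N" for n k
    using that AE_Dtr_entry[OF \<open>0 < lam\<close>] prob_space_Dtr[OF \<open>0 < lam\<close>]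
    by (intro AE_PiM_component[where P = "\<lambda>w. snd w \<in> {-1, 1} \<and> 0 \<le> snd w * entry d w k"]) auto
  then have "AE S in PiM {..N} (\<lambda>_. Dtr d lam c). \<forall>n\<in>{..N}. \<forall>k\<in>{..d}.
      snd (S n) \<in> {-1, 1} \<and> 0 \<le> snd (S n) * entry d (S n) k"
    by (intro eventually_ball_finite finite_atMost ballI) (simp only: atMost_iff)
  then show ?thesis
  proof (rule eventually_mono)
    fix S assume S: "\<forall>n\<in>{..N}. \<forall>k\<in>{..d}. snd (S n) \<in> {-1, 1} \<and> 0 \<le> snd (S n) * entry d (S n) k"
    have nn: "0 \<le> entry d (S n) k * entry d (S n) l" if "n \<le> N" "k \<le> d" "l \<le> d" for n k l
    proof -
      have "0 \<le> (snd (S n) * entry d (S n) k) * (snd (S n) * entry d (S n) l)"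
        by (rule mult_nonneg_nonneg) (use S that in auto)
      also have "\<dots> = (snd (S n) * snd (S n)) * (entry d (S n) k * entry d (S n) l)"
        by (simp add: mult_ac)
      also have "snd (S n) \<in> {-1, 1}"
        using S that by blast
      then have "snd (S n) * snd (S n) = 1" by auto
      finally show ?thesis by simp
    qed
    have w: "0 \<le> weight d N P Q S j" if "j < d" for j
      unfolding weight_def
    proof (intro sum_nonneg mult_nonneg_nonneg[OF _ nn])
      fix k l n assume "k \<in> {..d}" "l \<in> {..d}"
      then show "0 \<le> P $$ (d, k) * Q $$ (l, j) * (1 / real N)"
        using P Q that by (auto simp: admissible_def)
    qed auto
    have y: "snd (S N) \<in> {-1, 1}" using S by auto
    show "adv_loss d N eps P Q S =
        (\<Sum>j<d. weight d N P Q S j * (eps - entry d (S N) d * entry d (S N) j))"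
      using P Q y w \<open>0 \<le> eps\<close>
      by (subst adv_loss_eq) (auto simp: admissible_def entry_def algebra_simps intro!: sum.cong)
  qed
qed

text \<open>The supremum in the loss has to be evaluated for all samples, not just almost surely, since the
  Bochner integral of a function that is only almost everywhere equal to a measurable one is \<open>0\<close>.\<close>

lemma measurable_adv_loss:
  assumes "P \<in> carrier_mat (d+1) (d+1)" "Q \<in> carrier_mat (d+1) (d+1)" "0 \<le> eps"
  shows "adv_loss d N eps P Q \<in> borel_measurable (PiM {..N} (\<lambda>_. Dtr d lam c))"
proof -
  have E [measurable]: "(\<lambda>S. entry d (S n) k) \<in> borel_measurable (PiM {..N} (\<lambda>_. Dtr d lam c))"
    if "n \<le> N" for n k
    using that by (intro measurable_compose[OF measurable_component_singleton[of n]]) auto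
  have "adv_loss d N eps P Q = (\<lambda>S. \<Sum>j<d. eps * \<bar>entry d (S N) d * weight d N P Q S j\<bar> -
      entry d (S N) d * weight d N P Q S j * entry d (S N) j)"
    using assms by (auto simp: adv_loss_eq entry_def intro!: ext sum.cong)
  also have "\<dots> \<in> borel_measurable (PiM {..N} (\<lambda>_. Dtr d lam c))"
    unfolding weight_def
    by (intro borel_measurable_sum borel_measurable_diff borel_measurable_times
        borel_measurable_abs borel_measurable_const E) auto
  finally show ?thesis .
qed

text \<open>Each summand couples one demonstration \<open>n < N\<close> with the query
  \<open>N\<close>, so its expectation factors. The \<open>N\<close> demonstrations contribute
  equally, which cancels \<open>1 / real N\<close>.\<close>

lemma integral_adv_loss:
  assumes P: "admissible d P" and Q: "admissible d Q" and "0 \<le> eps" "0 < lam" "c < d" "1 \<le> N"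
  shows "(\<integral>S. adv_loss d N eps P Q S \<partial>PiM {..N} (\<lambda>_. Dtr d lam c)) =
    - (\<Sum>j<d. \<Sum>k\<le>d. \<Sum>l\<le>d. P $$ (d, k) * Q $$ (l, j) *
        (cross_moment d lam c k l * (cross_moment d lam c d j - eps)))"
proof -
  let ?M = "PiM {..N} (\<lambda>_. Dtr d lam c)"
  let ?F = "\<lambda>S. \<Sum>j<d. weight d N P Q S j * (eps - entry d (S N) d * entry d (S N) j)"
  interpret prob_space "Dtr d lam c" using prob_space_Dtr[OF \<open>0 < lam\<close>] .
  have c: "has_bochner_integral (Dtr d lam c) (\<lambda>_. eps) eps"
    by (rule has_bochner_integral_const)
  have "has_bochner_integral ?M (\<lambda>S. \<Sum>j<d. \<Sum>k\<le>d. \<Sum>l\<le>d. \<Sum>n<N.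
      P $$ (d, k) * Q $$ (l, j) * (1 / real N) *
        ((entry d (S n) k * entry d (S n) l) * (eps - entry d (S N) d * entry d (S N) j)))
     (\<Sum>j<d. \<Sum>k\<le>d. \<Sum>l\<le>d. \<Sum>n<N. P $$ (d, k) * Q $$ (l, j) * (1 / real N) *
        (cross_moment d lam c k l * (eps - cross_moment d lam c d j)))"
    using assms prob_space_Dtr[OF \<open>0 < lam\<close>, of d c] c
    by (intro has_bochner_integral_sum has_bochner_integral_mult_right
          has_bochner_integral_PiM_two[where f = "\<lambda>w. entry d w _ * entry d w _" and g = "\<lambda>w. eps - entry d w d * entry d w _"]
          has_bochner_integral_diff has_bochner_integral_Dtr_entry) auto
  moreover have "(\<Sum>j<d. \<Sum>k\<le>d. \<Sum>l\<le>d. \<Sum>n<N.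
      P $$ (d, k) * Q $$ (l, j) * (1 / real N) *
        ((entry d (S n) k * entry d (S n) l) * (eps - entry d (S N) d * entry d (S N) j))) = ?F S" for S
    unfolding weight_def sum_distrib_right by (simp add: mult.assoc)
  ultimately have "integral\<^sup>L ?M ?F = (\<Sum>j<d. \<Sum>k\<le>d. \<Sum>l\<le>d. \<Sum>n<N.
      P $$ (d, k) * Q $$ (l, j) * (1 / real N) *
        (cross_moment d lam c k l * (eps - cross_moment d lam c d j)))" "integrable ?M ?F"
    by (simp_all add: has_bochner_integral_iff)
  note F = this
  have "(\<integral>S. adv_loss d N eps P Q S \<partial>?M) = integral\<^sup>L ?M ?F"
    using P Q F(2) AE_adv_loss[OF P Q \<open>0 \<le> eps\<close> \<open>0 < lam\<close>] \<open>0 \<le> eps\<close>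
    by (intro integral_cong_AE measurable_adv_loss) (auto simp: admissible_def)
  also have "\<dots> = - (\<Sum>j<d. \<Sum>k\<le>d. \<Sum>l\<le>d. P $$ (d, k) * Q $$ (l, j) *
        (cross_moment d lam c k l * (cross_moment d lam c d j - eps)))"
    unfolding F sum_negf[symmetric] using \<open>1 \<le> N\<close>
    by (intro sum.cong refl) (simp add: right_diff_distrib)
  finally show ?thesis .
qed

section \<open>The coefficients of the bilinear form\<close>

text \<open>Demonstrations and query are independent only given \<open>c\<close>, so this is a sum
  of products over \<open>c\<close> and not a product of sums. The factor \<open>1 / real d\<close>
  stays outside.\<close>

definition coef :: "nat \<Rightarrow> real \<Rightarrow> real \<Rightarrow> nat \<Rightarrow> nat \<Rightarrow> nat \<Rightarrow> real" where
  "coef d lam eps j k l = (\<Sum>c<d. cross_moment d lam c k l * (first_moment d lam c j - eps))"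

lemma adv_risk_eq:
  assumes "admissible d P" "admissible d Q" "0 \<le> eps" "0 < lam" "1 \<le> N"
  shows "adv_risk d N lam eps P Q =
    - (1 / real d) * (\<Sum>j<d. \<Sum>k\<le>d. \<Sum>l\<le>d. P $$ (d, k) * Q $$ (l, j) * coef d lam eps j k l)"
proof -
  have "(\<Sum>c<d. \<integral>S. adv_loss d N eps P Q S \<partial>PiM {..N} (\<lambda>_. Dtr d lam c)) =
    - (\<Sum>c<d. \<Sum>j<d. \<Sum>k\<le>d. \<Sum>l\<le>d. P $$ (d, k) * Q $$ (l, j) *
        (cross_moment d lam c k l * (first_moment d lam c j - eps)))"
    using assms
    by (simp add: integral_adv_loss sum_negf cross_moment_def[of d lam _ d] first_moment_def)
  also have "(\<Sum>c<d. \<Sum>j<d. \<Sum>k\<le>d. \<Sum>l\<le>d. P $$ (d, k) * Q $$ (l, j) *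
        (cross_moment d lam c k l * (first_moment d lam c j - eps))) =
     (\<Sum>j<d. \<Sum>k\<le>d. \<Sum>l\<le>d. P $$ (d, k) * Q $$ (l, j) * coef d lam eps j k l)"
    unfolding coef_def sum_distrib_left
    by (rule trans[OF sum.swap], rule sum.cong[OF refl])+ simp
  finally show ?thesis by (simp add: adv_risk_def)
qed

subsection \<open>Signs and maxima of the bilinear form\<close>

text \<open>The target \<open>c\<close> enters \<open>coef\<close> only through its equality with
  one of the indices. \<open>T\<close> will be the set of these exceptional targets and
  \<open>z\<close> the common contribution of all others.\<close>

lemma sum_const_outside:
  fixes f :: "'a \<Rightarrow> real"
  assumes "finite A" "T \<subseteq> A" "\<And>c. c \<in> A - T \<Longrightarrow> f c = z"
  shows "sum f A = sum f T + (real (card A) - real (card T)) * z"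
proof -
  have "sum f A = sum f T + sum f (A - T)"
    using assms(1,2) by (metis add.commute sum.subset_diff)
  also have "sum f (A - T) = real (card A - card T) * z"
    using assms by (simp add: card_Diff_subset finite_subset)
  also have "real (card A - card T) = real (card A) - real (card T)"
    using assms by (simp add: card_mono of_nat_diff)
  finally show ?thesis .
qed

lemma coef_sym: "coef d lam eps j k l = coef d lam eps j l k"
  unfolding coef_def cross_moment_def by (intro sum.cong) auto

text \<open>\<open>eps\<close> is subtracted from a factor whose cofactors are nonnegative moments.
  Case (1) thus has to be settled only at its threshold.\<close>

lemma coef_antimono:
  assumes "eps \<le> eps'" "0 < lam"
  shows "coef d lam eps' j k l \<le> coef d lam eps j k l"
  unfolding coef_def using assms
  by (intro sum_mono mult_left_mono)
     (auto simp: cross_moment_def first_moment_def second_moment_def)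

text \<open>The target \<open>c = j\<close> contributes its cross moment times \<open>a\<close>,
  every other target its cross moment times \<open>-b\<close>. In each formula the multiplier of
  \<open>b\<close> thus collects the cross moments over \<open>c\<close> different from
  \<open>j\<close>; the numbers \<open>real d - 2\<close> and \<open>real d - 3\<close> count the
  targets that match none of the indices.\<close>

lemma
  fixes lam eps :: real
  assumes j: "j < d"
  defines "\<mu> \<equiv> lam / 2" and "s \<equiv> lam\<^sup>2 / 3" and "a \<equiv> 1 - eps" and "b \<equiv> eps - lam / 2"
  shows coef_jj: "coef d lam eps j j j = a - (real d - 1) * s * b"
    and coef_jd: "coef d lam eps j j d = a - (real d - 1) * \<mu> * b"
    and coef_dj: "coef d lam eps j d j = a - (real d - 1) * \<mu> * b"
    and coef_dd: "coef d lam eps j d d = a - (real d - 1) * b"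
    and coef_jk: "\<And>k. k < d \<Longrightarrow> k \<noteq> j \<Longrightarrow> coef d lam eps j j k = \<mu> * (a - b * (1 + (real d - 2) * \<mu>))"
    and coef_kj: "\<And>k. k < d \<Longrightarrow> k \<noteq> j \<Longrightarrow> coef d lam eps j k j = \<mu> * (a - b * (1 + (real d - 2) * \<mu>))"
    and coef_dk: "\<And>k. k < d \<Longrightarrow> k \<noteq> j \<Longrightarrow> coef d lam eps j d k = \<mu> * a - b * (1 + (real d - 2) * \<mu>)"
    and coef_kd: "\<And>k. k < d \<Longrightarrow> k \<noteq> j \<Longrightarrow> coef d lam eps j k d = \<mu> * a - b * (1 + (real d - 2) * \<mu>)"
    and coef_kk: "\<And>k. k < d \<Longrightarrow> k \<noteq> j \<Longrightarrow> coef d lam eps j k k = s * a - b * (1 + (real d - 2) * s)"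
    and coef_kl: "\<And>k l. k < d \<Longrightarrow> l < d \<Longrightarrow> k \<noteq> j \<Longrightarrow> l \<noteq> j \<Longrightarrow> k \<noteq> l \<Longrightarrow>
      coef d lam eps j k l = \<mu>\<^sup>2 * a - b * (2 * \<mu> + (real d - 3) * \<mu>\<^sup>2)"
proof -
  note defs = coef_def cross_moment_def first_moment_def second_moment_def
  \<comment> \<open>With \<open>eps\<close> and \<open>a\<close> eliminated, each claim is a
    polynomial identity in \<open>\<mu>\<close>, \<open>s\<close>, \<open>b\<close> and
    \<open>real d\<close>.\<close>
  have m: "eps = \<mu> + b" "a = 1 - \<mu> - b" by (simp_all add: \<mu>_def a_def b_def)
  show "coef d lam eps j j j = a - (real d - 1) * s * b"
    unfolding defs \<mu>_def[symmetric] s_def[symmetric] using j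
    by (subst sum_const_outside[where T = "{j}" and z = "s * (- b)"]) (auto simp: m algebra_simps)
  show jd: "coef d lam eps j j d = a - (real d - 1) * \<mu> * b"
    unfolding defs \<mu>_def[symmetric] s_def[symmetric] using j
    by (subst sum_const_outside[where T = "{j}" and z = "\<mu> * (- b)"]) (auto simp: m algebra_simps)
  then show "coef d lam eps j d j = a - (real d - 1) * \<mu> * b" by (simp add: coef_sym)
  show "coef d lam eps j d d = a - (real d - 1) * b"
    unfolding defs \<mu>_def[symmetric] s_def[symmetric] using j
    by (subst sum_const_outside[where T = "{j}" and z = "- b"]) (auto simp: m algebra_simps)
  show jk: "coef d lam eps j j k = \<mu> * (a - b * (1 + (real d - 2) * \<mu>))" if "k < d" "k \<noteq> j" for k
    unfolding defs \<mu>_def[symmetric] s_def[symmetric] using j that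
    by (subst sum_const_outside[where T = "{j, k}" and z = "\<mu> * \<mu> * (- b)"]) (auto simp: m algebra_simps)
  show "coef d lam eps j k j = \<mu> * (a - b * (1 + (real d - 2) * \<mu>))" if "k < d" "k \<noteq> j" for k
    using jk[OF that] by (simp add: coef_sym)
  show dk: "coef d lam eps j d k = \<mu> * a - b * (1 + (real d - 2) * \<mu>)" if "k < d" "k \<noteq> j" for k
    unfolding defs \<mu>_def[symmetric] s_def[symmetric] using j that
    by (subst sum_const_outside[where T = "{j, k}" and z = "\<mu> * (- b)"]) (auto simp: m algebra_simps)
  show "coef d lam eps j k d = \<mu> * a - b * (1 + (real d - 2) * \<mu>)" if "k < d" "k \<noteq> j" for k
    using dk[OF that] by (simp add: coef_sym)
  show "coef d lam eps j k k = s * a - b * (1 + (real d - 2) * s)" if "k < d" "k \<noteq> j" for k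
    unfolding defs \<mu>_def[symmetric] s_def[symmetric] using j that
    by (subst sum_const_outside[where T = "{j, k}" and z = "s * (- b)"]) (auto simp: m algebra_simps)
  show "coef d lam eps j k l = \<mu>\<^sup>2 * a - b * (2 * \<mu> + (real d - 3) * \<mu>\<^sup>2)"
    if "k < d" "l < d" "k \<noteq> j" "l \<noteq> j" "k \<noteq> l" for k l
    unfolding defs \<mu>_def[symmetric] s_def[symmetric] using j that
    by (subst sum_const_outside[where T = "{j, k, l}" and z = "\<mu> * \<mu> * (- b)"])
       (auto simp: m algebra_simps power2_eq_square)
qed

lemma sum_atMost_split:
  fixes f :: "nat \<Rightarrow> real"
  assumes "j < d"
  shows "(\<Sum>k\<le>d. f k) = f d + f j + (\<Sum>k\<in>{..<d} - {j}. f k)"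
proof -
  have "(\<Sum>k\<le>d. f k) = f d + (\<Sum>k<d. f k)"
    by (simp flip: lessThan_Suc_atMost)
  also have "(\<Sum>k<d. f k) = f j + (\<Sum>k\<in>{..<d} - {j}. f k)"
    using assms by (subst sum.remove[of _ j]) auto
  finally show ?thesis by simp
qed

section \<open>Large perturbations: all coefficients are nonpositive\<close>

text \<open>The hypothesis on \<open>eps\<close> says exactly that the entry \<open>(j, j)\<close>
  is nonpositive. Up to a positive factor every other entry is \<open>t * a - x * b\<close> with
  \<open>t <= 1\<close> and \<open>x >= (D - 1) * s\<close>, because \<open>s <= \<mu> <= 1\<close>,
  so none of them turns nonpositive later.\<close>

lemma coef_nonpos:
  assumes lam: "0 < lam" "lam < 1" and j: "j < d" and kl: "k \<le> d" "l \<le> d"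
    and eps: "eps \<ge> lam / 2 + 3 / 2 * ((2 - lam) / ((real d - 1) * lam ^ 2 + 3))"
  shows "coef d lam eps j k l \<le> 0"
proof -
  define \<mu> s a b D where "\<mu> = lam / 2" "s = lam\<^sup>2 / 3" "a = 1 - eps" "b = eps - \<mu>" "D = real d"
  note defs = this
  have D: "1 \<le> D" using j by (simp add: defs)
  have \<mu>: "0 < \<mu>" "\<mu> < 1" "0 < s" using lam by (auto simp: defs)
  have "lam * lam \<le> lam" using lam by simp
  then have s\<mu>: "s \<le> \<mu>" "s \<le> 1" using lam unfolding defs power2_eq_square by linarith+
  have pos: "0 < (D - 1) * s + 1" using D \<mu> by (simp add: add_nonneg_pos)
  have "3 / 2 * ((2 - lam) / ((D - 1) * lam ^ 2 + 3)) = (1 - \<mu>) / ((D - 1) * s + 1)"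
    using pos by (auto simp: defs field_simps)
  then have "(1 - \<mu>) / ((D - 1) * s + 1) \<le> b" using eps by (simp add: defs)
  then have *: "1 - \<mu> \<le> b * ((D - 1) * s + 1)" using pos by (simp add: field_simps)
  have "0 < b * ((D - 1) * s + 1)" using * \<mu> by linarith
  then have b: "0 < b" using pos by (simp add: zero_less_mult_iff)
  have "a + b = 1 - \<mu>" by (simp add: defs)
  with * have a: "a \<le> (D - 1) * s * b" by (simp add: algebra_simps)
  have ab: "a \<le> x * b" if "(D - 1) * s \<le> x" for x
    using a mult_right_mono[OF that, of b] b by linarith
  have kab: "t * a \<le> x * b" if "(D - 1) * s \<le> x" "0 \<le> t" "t \<le> 1" for x t
  proof (cases "0 \<le> a")
    case True
    then show ?thesis using ab[OF that(1)] mult_right_mono[OF that(3) True] by linarith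
  next
    case False
    then have "t * a \<le> 0" using that by (simp add: mult_nonneg_nonpos)
    also have "0 \<le> (D - 1) * s" using D \<mu> by simp
    then have "0 \<le> x * b" using b that by simp
    finally show ?thesis .
  qed
  have x: "(D - 1) * s \<le> (D - 1) * \<mu>" "(D - 1) * s \<le> D - 1"
    using D s\<mu> by (auto intro: mult_left_mono mult_left_le)
  have x2: "(D - 1) * s \<le> 1 + (D - 2) * \<mu>" "(D - 1) * s \<le> 1 + (D - 2) * s" if "2 \<le> D"
    using mult_left_mono[OF s\<mu>(1), of "D - 2"] that s\<mu> by (auto simp: algebra_simps)
  \<comment> \<open>This is the multiplier of \<open>b\<close> in the entry \<open>(k, l)\<close>
    after a factor \<open>\<mu>\<close> is taken out. Three distinct indices force
    \<open>D >= 3\<close>.\<close>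
  have x3: "(D - 1) * s \<le> 2 + (D - 3) * \<mu>" if "3 \<le> D"
    using mult_left_mono[OF s\<mu>(1), of "D - 3"] that s\<mu> by (auto simp: algebra_simps)
  note cf = coef_jj[OF j, of lam eps] coef_jd[OF j, of lam eps] coef_dj[OF j, of lam eps]
    coef_dd[OF j, of lam eps] coef_jk[OF j, of _ lam eps] coef_kj[OF j, of _ lam eps]
    coef_dk[OF j, of _ lam eps] coef_kd[OF j, of _ lam eps] coef_kk[OF j, of _ lam eps]
    coef_kl[OF j, of _ _ lam eps]
  note cf = cf[folded \<open>\<mu> = lam / 2\<close>, folded \<open>s = lam\<^sup>2 / 3\<close> \<open>a = 1 - eps\<close> \<open>b = eps - \<mu>\<close> \<open>D = real d\<close>]
  have D2: "2 \<le> D" if "k' < d" "k' \<noteq> j" for k' using that j by (auto simp: defs)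
  have D3: "3 \<le> D" if "k' < d" "k' \<noteq> j" "l' < d" "l' \<noteq> j" "k' \<noteq> l'" for k' l'
  proof -
    have "card {j, k', l'} \<le> card {..<d}" using that j by (intro card_mono) auto
    then show ?thesis using that by (simp add: defs)
  qed
  have jk: "\<mu> * (a - b * (1 + (D - 2) * \<mu>)) \<le> 0" if "2 \<le> D"
    using ab[OF x2(1)[OF that]] \<mu> by (simp add: mult_le_0_iff mult.commute)
  have dk: "\<mu> * a - b * (1 + (D - 2) * \<mu>) \<le> 0" if "2 \<le> D"
    using kab[OF x2(1)[OF that], of \<mu>] \<mu> by (simp add: mult.commute)
  have kk: "s * a - b * (1 + (D - 2) * s) \<le> 0" if "2 \<le> D"
    using kab[OF x2(2)[OF that], of s] \<mu> s\<mu> by (simp add: mult.commute)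
  have kl': "\<mu>\<^sup>2 * a - b * (2 * \<mu> + (D - 3) * \<mu>\<^sup>2) \<le> 0" if "3 \<le> D"
  proof -
    have "\<mu> * (\<mu> * a - (2 + (D - 3) * \<mu>) * b) \<le> 0"
      using kab[OF x3[OF that], of \<mu>] \<mu> by (simp add: mult_le_0_iff)
    then show ?thesis by (simp add: algebra_simps power2_eq_square)
  qed
  have jd: "coef d lam eps j d d \<le> 0" "coef d lam eps j j j \<le> 0" "coef d lam eps j j d \<le> 0"
    "coef d lam eps j d j \<le> 0"
    unfolding cf using ab[OF x(1)] ab[OF x(2)] a by simp_all
  have one: "coef d lam eps j j k' \<le> 0" "coef d lam eps j k' j \<le> 0" "coef d lam eps j d k' \<le> 0"
    "coef d lam eps j k' d \<le> 0" "coef d lam eps j k' k' \<le> 0" if "k' < d" "k' \<noteq> j" for k'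
    unfolding cf(5-9)[OF that] using jk dk kk D2[OF that] by simp_all
  consider "k = j \<or> k = d" | "k < d" "k \<noteq> j" using kl by linarith
  then show ?thesis
  proof cases
    case 1
    consider "l = j" | "l = d" | "l < d" "l \<noteq> j" using kl by linarith
    then show ?thesis using 1 jd one[of l] by cases metis+
  next
    case k: 2
    consider "l = j" | "l = d" | "l = k" | "l < d" "l \<noteq> j" "k \<noteq> l" using kl by linarith
    then show ?thesis
    proof cases
      case 4
      then show ?thesis
        unfolding cf(10)[OF k(1) 4(1) k(2) 4(2,3)] using kl' D3[OF k 4] by simp
    qed (use one[OF k] in simp_all)
  qed
qed

text \<open>Only the columns in \<open>B\<close> are nonnegative, so the weights there are raised to \<open>1\<close> first; the
  remaining weights can then be raised because all row sums have become nonnegative.\<close>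

lemma bilinear_le_sum:
  fixes A :: "'a \<Rightarrow> 'a \<Rightarrow> real"
  assumes fin: "finite I"
    and sym: "\<And>k l. k \<in> I \<Longrightarrow> l \<in> I \<Longrightarrow> A k l = A l k"
    and B: "\<And>k l. k \<in> I \<Longrightarrow> l \<in> I \<inter> B \<Longrightarrow> 0 \<le> A k l"
    and row: "\<And>q k. (\<forall>l\<in>I. 0 \<le> q l \<and> q l \<le> 1 \<and> (l \<in> B \<longrightarrow> q l = 1)) \<Longrightarrow> k \<in> I \<Longrightarrow>
      0 \<le> (\<Sum>l\<in>I. A k l * q l)"
    and p: "\<And>k. k \<in> I \<Longrightarrow> 0 \<le> p k \<and> p k \<le> 1"
    and q: "\<And>k. k \<in> I \<Longrightarrow> 0 \<le> q k \<and> q k \<le> 1"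
  shows "(\<Sum>k\<in>I. \<Sum>l\<in>I. p k * q l * A k l) \<le> (\<Sum>k\<in>I. \<Sum>l\<in>I. A k l)"
proof -
  define q' where "q' l = (if l \<in> B then 1 else q l)" for l
  have "(\<Sum>k\<in>I. \<Sum>l\<in>I. p k * q l * A k l) \<le> (\<Sum>k\<in>I. \<Sum>l\<in>I. p k * (q' l * A k l))"
    unfolding mult.assoc using B p q
    by (intro sum_mono mult_left_mono) (auto simp: q'_def intro: mult_left_le_one_le)
  also have "\<dots> = (\<Sum>k\<in>I. p k * (\<Sum>l\<in>I. A k l * q' l))"
    by (simp add: sum_distrib_left mult_ac)
  also have "\<dots> \<le> (\<Sum>k\<in>I. \<Sum>l\<in>I. A k l * q' l)"
  proof (intro sum_mono mult_left_le_one_le)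
    fix k assume "k \<in> I"
    then show "0 \<le> (\<Sum>l\<in>I. A k l * q' l)"
      using q by (intro row) (auto simp: q'_def)
  qed (use p in auto)
  also have "\<dots> = (\<Sum>l\<in>I. q' l * (\<Sum>k\<in>I. A l k * 1))"
    using sym by (subst sum.swap) (auto simp: sum_distrib_left mult_ac intro!: sum.cong)
  also have "\<dots> \<le> (\<Sum>l\<in>I. \<Sum>k\<in>I. A l k * 1)"
  proof (intro sum_mono mult_left_le_one_le)
    fix l assume "l \<in> I"
    then show "0 \<le> (\<Sum>k\<in>I. A l k * 1)" by (intro row) auto
  qed (use q in \<open>auto simp: q'_def\<close>)
  finally show ?thesis by simp
qed

section \<open>Small perturbations: the all-ones weights\<close>

text \<open>At the threshold \<open>e\<close>, a row \<open>k\<close> outside \<open>{j, d}\<close>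
  has the entries \<open>\<beta> >= 0\<close> at \<open>j\<close>, 0 at \<open>d\<close>,
  \<open>\<gamma> <= 0\<close> at \<open>k\<close> and \<open>\<delta> <= 0\<close> at the
  \<open>D - 2\<close> other places. Its worst weighted sum is
  \<open>\<beta> + \<gamma> + (D - 2) * \<delta>\<close>, which is a nonnegative multiple of the
  variance \<open>s - \<mu>\<^sup>2\<close> of an ordinary feature.\<close>

lemma coef_le_std:
  assumes lam: "0 < lam" "lam < 1" and j: "j < d"
    and eps: "eps \<le> lam * (lam * (real d - 2) + 4) / (2 * (lam * (real d - 1) + 2))"
    and p: "\<And>k. k \<le> d \<Longrightarrow> 0 \<le> p k \<and> p k \<le> 1"
    and q: "\<And>k. k \<le> d \<Longrightarrow> 0 \<le> q k \<and> q k \<le> 1"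
  shows "(\<Sum>k\<le>d. \<Sum>l\<le>d. p k * q l * coef d lam eps j k l) \<le> (\<Sum>k\<le>d. \<Sum>l\<le>d. coef d lam eps j k l)"
proof -
  define e where "e = lam * (lam * (real d - 2) + 4) / (2 * (lam * (real d - 1) + 2))"
  define \<mu> s a b D where "\<mu> = lam / 2" "s = lam\<^sup>2 / 3" "a = 1 - e" "b = e - \<mu>" "D = real d"
  note defs = this
  have D: "1 \<le> D" using j by (simp add: defs)
  have \<mu>: "0 < \<mu>" "\<mu> < 1" "0 < s" using lam by (auto simp: defs)
  have "lam * lam \<le> lam" using lam by simp
  then have s\<mu>: "s \<le> \<mu>" "s \<le> 1" using lam unfolding defs power2_eq_square by linarith+
  have \<mu>s: "\<mu>\<^sup>2 \<le> s" by (simp add: defs power2_eq_square)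
  have pos: "0 < 1 + (D - 1) * \<mu>" using D \<mu> by (simp add: add_pos_nonneg)
  have "e = \<mu> * (\<mu> * (D - 2) + 2) / (1 + (D - 1) * \<mu>)"
    using pos unfolding e_def by (simp add: defs(1,5) field_simps)
  then have e: "e * (1 + (D - 1) * \<mu>) = \<mu> * (\<mu> * (D - 2) + 2)" using pos by simp
  have bpos: "b * (1 + (D - 1) * \<mu>) = \<mu> * (1 - \<mu>)"
    using e by (simp add: defs(4) algebra_simps)
  then have b: "0 \<le> b"
    using pos \<mu> by (metis less_eq_real_def mult_nonneg_nonneg mult_pos_pos not_less
      zero_le_mult_iff diff_ge_0_iff_ge order.asym)
  have \<mu>a: "\<mu> * a = b * (1 - \<mu> + (D - 1) * \<mu>)"
    using e by (simp add: defs(3,4) algebra_simps)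
  \<comment> \<open>The values \<open>s\<close>, \<open>\<mu>\<close> and \<open>1\<close> of
    \<open>x\<close> give the signs of the entries \<open>(j, j)\<close>, \<open>(j, d)\<close> and
    \<open>(d, d)\<close>.\<close>
  have aD: "(D - 1) * x * b \<le> a" if "0 \<le> x" "x \<le> 1" for x
  proof -
    have "\<mu> * ((D - 1) * x * b) \<le> \<mu> * ((D - 1) * 1 * b)"
      using that D b \<mu> by (intro mult_left_mono mult_right_mono) auto
    also have "\<dots> \<le> b * (1 - \<mu> + (D - 1) * \<mu>)" using b \<mu> mult_left_le_one_le[of b \<mu>] by (simp add: algebra_simps)
    finally have "\<mu> * ((D - 1) * x * b) \<le> \<mu> * a" using \<mu>a by simp
    then show ?thesis by (rule mult_left_le_imp_le) (rule \<mu>)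
  qed
  note cf = coef_jj[OF j, of lam e] coef_jd[OF j, of lam e] coef_dj[OF j, of lam e]
    coef_dd[OF j, of lam e] coef_jk[OF j, of _ lam e] coef_kj[OF j, of _ lam e]
    coef_dk[OF j, of _ lam e] coef_kd[OF j, of _ lam e] coef_kk[OF j, of _ lam e]
    coef_kl[OF j, of _ _ lam e]
  note cf = cf[folded \<open>\<mu> = lam / 2\<close>, folded \<open>s = lam\<^sup>2 / 3\<close> \<open>a = 1 - e\<close> \<open>b = e - \<mu>\<close> \<open>D = real d\<close>]
  define \<beta> \<gamma> \<delta> where "\<beta> = \<mu> * (a - b * (1 + (D - 2) * \<mu>))"
    "\<gamma> = s * a - b * (1 + (D - 2) * s)" "\<delta> = \<mu>\<^sup>2 * a - b * (2 * \<mu> + (D - 3) * \<mu>\<^sup>2)"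
  note gr = this
  \<comment> \<open>The threshold \<open>e\<close> is the value of \<open>eps\<close> at which the entries \<open>(d, k)\<close> vanish.\<close>
  have \<alpha>: "\<mu> * a - b * (1 + (D - 2) * \<mu>) = 0" using \<mu>a by (simp add: algebra_simps)
  have \<beta>: "\<beta> = b * (1 + (D - 2) * \<mu>) * (1 - \<mu>)"
    using \<alpha> unfolding gr by (simp add: algebra_simps)
  have \<beta>0: "0 \<le> \<beta>"
  proof -
    have "1 + (D - 2) * \<mu> = (1 - \<mu>) + (D - 1) * \<mu>" by (simp add: algebra_simps)
    moreover have "0 \<le> (D - 1) * \<mu>" using D \<mu> by simp
    ultimately have "0 \<le> 1 + (D - 2) * \<mu>" using \<mu> by linarith
    then show ?thesis unfolding \<beta> using b \<mu> by simp
  qed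
  have "\<delta> = \<mu> * (\<mu> * a) - b * (2 * \<mu> + (D - 3) * \<mu>\<^sup>2)"
    unfolding gr by (simp add: power2_eq_square)
  then have \<delta>: "\<delta> = - (b * \<mu> * (1 - \<mu>))"
    unfolding \<mu>a by (simp add: algebra_simps power2_eq_square)
  have \<delta>0: "\<delta> \<le> 0" unfolding \<delta> using b \<mu> by simp
  have "\<mu> * \<gamma> = s * (\<mu> * a) - \<mu> * b * (1 + (D - 2) * s)"
    unfolding gr by (simp add: algebra_simps)
  then have \<gamma>: "\<mu> * \<gamma> = b * (s - \<mu>)"
    unfolding \<mu>a by (simp add: algebra_simps)
  then have "\<mu> * \<gamma> \<le> 0" using b s\<mu> by (simp add: mult_nonneg_nonpos)
  then have \<gamma>0: "\<gamma> \<le> 0" using \<mu> by (simp add: mult_le_0_iff)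
  have "\<mu> * (\<beta> + \<gamma> + (D - 2) * \<delta>) = b * (s - \<mu>\<^sup>2)"
    unfolding distrib_left \<gamma> unfolding \<beta> \<delta> by (simp add: algebra_simps power2_eq_square)
  then have "0 \<le> \<mu> * (\<beta> + \<gamma> + (D - 2) * \<delta>)" using b \<mu>s by simp
  then have S: "0 \<le> \<beta> + \<gamma> + (D - 2) * \<delta>" using \<mu> by (simp add: zero_le_mult_iff)
  have mono: "coef d lam e j k l \<le> coef d lam eps j k l" for k l
    using eps lam by (intro coef_antimono) (auto simp: e_def)
  have nn: "0 \<le> coef d lam e j k l" if kl: "k \<le> d" "l \<in> {j, d}" for k l
  proof -
    consider "k = d" | "k = j" | "k < d" "k \<noteq> j" using kl(1) by linarith
    then show ?thesis
      using aD[of s] aD[of \<mu>] aD[of 1] \<mu> s\<mu> \<beta>0 \<alpha> kl(2) by cases (auto simp: cf gr(1))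
  qed
  show ?thesis
  proof (rule bilinear_le_sum[where B = "{j, d}"])
    show "0 \<le> coef d lam eps j k l" if "k \<in> {..d}" "l \<in> {..d} \<inter> {j, d}" for k l
      using nn[of k l] mono[of k l] that by auto
    fix r :: "nat \<Rightarrow> real" and k assume r: "\<forall>l\<in>{..d}. 0 \<le> r l \<and> r l \<le> 1 \<and> (l \<in> {j, d} \<longrightarrow> r l = 1)"
      and k: "k \<in> {..d}"
    have rj: "r j = 1" "r d = 1" using r j by auto
    have "0 \<le> (\<Sum>l\<le>d. coef d lam e j k l * r l)"
    proof (cases "k \<in> {j, d}")
      case True
      then show ?thesis
        using nn[of _ k] r coef_sym[of d lam e j k] by (intro sum_nonneg) auto
    next
      case False
      then have kd: "k < d" "k \<noteq> j" using k by auto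
      have "(\<Sum>l\<in>{..<d} - {j} - {k}. \<delta>) \<le> (\<Sum>l\<in>{..<d} - {j} - {k}. \<delta> * r l)"
        using r \<delta>0 by (intro sum_mono) (auto simp: mult_le_cancel_left1 intro!: mult_left_mono_neg[of _ 1, simplified])
      also have "(\<Sum>l\<in>{..<d} - {j} - {k}. \<delta>) = (D - 2) * \<delta>"
        using kd j by (simp add: defs of_nat_diff)
      also have "(\<Sum>l\<in>{..<d} - {j} - {k}. \<delta> * r l) = (\<Sum>l\<in>{..<d} - {j} - {k}. coef d lam e j k l * r l)"
        using kd by (intro sum.cong) (auto simp: cf gr(3))
      finally have 1: "(D - 2) * \<delta> \<le> (\<Sum>l\<in>{..<d} - {j} - {k}. coef d lam e j k l * r l)" .
      have 2: "\<gamma> \<le> \<gamma> * r k"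
        using r \<gamma>0 kd mult_left_mono_neg[of "r k" 1 \<gamma>] by auto
      have "(\<Sum>l\<le>d. coef d lam e j k l * r l) = \<beta> + \<gamma> * r k +
          (\<Sum>l\<in>{..<d} - {j} - {k}. coef d lam e j k l * r l)"
        unfolding sum_atMost_split[OF j] using kd \<alpha>
        by (subst sum.remove[of _ k]) (auto simp: cf gr rj)
      then show ?thesis using S 1 2 by linarith
    qed
    also have "\<dots> \<le> (\<Sum>l\<le>d. coef d lam eps j k l * r l)"
      using mono r by (intro sum_mono mult_right_mono) auto
    finally show "0 \<le> (\<Sum>l\<le>d. coef d lam eps j k l * r l)" .
  qed (use p q coef_sym in auto)
qed

section \<open>The intermediate radius: the identity weights\<close>

text \<open>Compared with \<open>p = 1\<close>, the columns \<open>l = j\<close> lose three amounts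
  after summation over \<open>j\<close>: \<open>m * (m + 1 - T) * R\<close> from the entries
  \<open>(j, j)\<close>, \<open>(m + 1) * m * (1 - u) * \<kappa>\<close> from the label row, and
  \<open>\<mu> * (m - 1) * m * (m + 1 - T) * \<kappa>\<close> from the other rows. The label column
  can gain at most the first amount, since \<open>\<kappa> <= R\<close>; the columns of the other
  features gain at most the second and third, through the terms \<open>1 - u\<close> and
  \<open>X\<close>.\<close>

lemma coef_le_adv:
  assumes lam: "0 < lam" "lam < 1" and d: "1 \<le> d"
    and eps: "eps = (1 + (real d - 1) * (lam / 2)) / real d"
    and p: "\<And>k. k \<le> d \<Longrightarrow> 0 \<le> p k \<and> p k \<le> 1"
    and q: "\<And>l j. l \<le> d \<Longrightarrow> j < d \<Longrightarrow> 0 \<le> q l j \<and> q l j \<le> 1"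
  shows "(\<Sum>j<d. \<Sum>k\<le>d. \<Sum>l\<le>d. p k * q l j * coef d lam eps j k l) \<le> (\<Sum>j<d. \<Sum>k\<le>d. coef d lam eps j k j)"
proof -
  define \<mu> s a b m where "\<mu> = lam / 2" "s = lam\<^sup>2 / 3" "a = 1 - eps" "b = eps - \<mu>" "m = real d - 1"
  note defs = this
  define R \<kappa> where "R = (1 - s) * b" "\<kappa> = (1 - \<mu>) * b"
  note R\<kappa> = this
  have m: "0 \<le> m" "real d = m + 1" using d by (simp_all add: defs)
  have \<mu>: "0 < \<mu>" "\<mu> < 1 / 2" "0 < s" using lam by (auto simp: defs)
  have "lam * lam \<le> lam" using lam by simp
  then have s\<mu>: "s \<le> \<mu>" using lam unfolding defs power2_eq_square by linarith
  \<comment> \<open>This \<open>eps\<close> is the mean of the signed feature over a uniform target,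
    so \<open>A j d d\<close> is zero; that is \<open>a = m * b\<close>, and every coefficient
    becomes a multiple of \<open>R\<close> or \<open>\<kappa>\<close>.\<close>
  have "eps * real d = 1 + (real d - 1) * (lam / 2)" using eps d by simp
  then have "eps * (m + 1) = 1 + m * \<mu>" unfolding defs(1,5) by simp
  then have bm: "b * (m + 1) = 1 - \<mu>" and ab: "a = m * b"
    by (simp_all add: defs(3,4) algebra_simps)
  have "0 < b * (m + 1)" using bm \<mu> by simp
  then have b: "0 < b" using m by (simp add: zero_less_mult_iff)
  have \<kappa>: "0 < \<kappa>" "\<kappa> \<le> R" using b \<mu> s\<mu> by (auto simp: R\<kappa> intro: mult_right_mono)
  have cf: "coef d lam eps j j j = m * R" "coef d lam eps j j d = m * \<kappa>"
    "coef d lam eps j d j = m * \<kappa>" "coef d lam eps j d d = 0"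
    if j: "j < d" for j
    unfolding coef_jj[OF j] coef_jd[OF j] coef_dj[OF j] coef_dd[OF j]
    unfolding defs(1-4)[symmetric] ab R\<kappa> using m by (simp_all add: algebra_simps)
  have cf': "coef d lam eps j j k = \<mu> * (m - 1) * \<kappa>" "coef d lam eps j k j = \<mu> * (m - 1) * \<kappa>"
    "coef d lam eps j d k = - \<kappa>" "coef d lam eps j k d = - \<kappa>" "coef d lam eps j k k = - R"
    if j: "j < d" "k < d" "k \<noteq> j" for j k
    unfolding coef_jk[OF j] coef_kj[OF j] coef_dk[OF j] coef_kd[OF j] coef_kk[OF j]
    unfolding defs(1-4)[symmetric] ab R\<kappa> using m by (simp_all add: algebra_simps)
  have cf'': "coef d lam eps j k l = - 2 * \<mu> * \<kappa>"
    if j: "j < d" "k < d" "l < d" "k \<noteq> j" "l \<noteq> j" "k \<noteq> l" for j k l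
    unfolding coef_kl[OF j]
    unfolding defs(1-4)[symmetric] ab R\<kappa> using m by (simp add: algebra_simps power2_eq_square)
  define u where "u = p d"
  have u: "0 \<le> u" "u \<le> 1" using p by (auto simp: u_def)
  define T where "T = (\<Sum>k<d. p k)"
  have Tj: "(\<Sum>k\<in>{..<d} - {j}. p k) = T - p j" if "j < d" for j
    using that unfolding T_def by (subst sum_diff1) auto
  have Tjl: "(\<Sum>k\<in>{..<d} - {j} - {l}. p k) = T - p j - p l" if "j < d" "l < d" "l \<noteq> j" for j l
    using that Tj[OF that(1)] by (subst sum_diff1) auto
  have cardO: "real (card ({..<d} - {j})) = m" if "j < d" for j
    using that unfolding defs(5) by (simp add: of_nat_diff)
  have Tj_bounds: "0 \<le> T - p j" "T - p j \<le> m" if "j < d" for j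
  proof -
    have "(\<Sum>k\<in>{..<d} - {j}. p k) \<le> (\<Sum>k\<in>{..<d} - {j}. 1)"
      by (rule sum_mono) (use p in auto)
    moreover have "0 \<le> (\<Sum>k\<in>{..<d} - {j}. p k)"
      by (rule sum_nonneg) (use p in auto)
    ultimately show "0 \<le> T - p j" "T - p j \<le> m" using Tj[OF that] cardO[OF that] by simp_all
  qed
  have m1: "1 \<le> m" if "j < d" "l < d" "l \<noteq> j" for j l
    using that by (auto simp: defs(5))
  \<comment> \<open>The negative entries \<open>-2\<mu>\<kappa>\<close> absorb the term with \<open>p j = p l = 1\<close> only if \<open>T\<close> is large;
      if \<open>T\<close> is small, \<open>T \<le> m + 1 - T\<close> makes the cruder bound sufficient.\<close>
  define X where "X j l = (if 2 * T \<le> m + 1 then \<mu> * (m - 1) * p j else \<mu> * (m - 1) * p j * (1 - p l))"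
    for j l
  define G where "G j l = (\<Sum>k\<le>d. p k * coef d lam eps j k l)" for j l
  have Gj: "G j j = p j * m * R + u * m * \<kappa> + \<mu> * (m - 1) * \<kappa> * (T - p j)" if j: "j < d" for j
  proof -
    have "(\<Sum>k\<in>{..<d} - {j}. p k * coef d lam eps j k j) = (\<Sum>k\<in>{..<d} - {j}. \<mu> * (m - 1) * \<kappa> * p k)"
      using j by (intro sum.cong) (auto simp: cf')
    also have "\<dots> = \<mu> * (m - 1) * \<kappa> * (T - p j)" using Tj[OF j] by (simp flip: sum_distrib_left)
    finally show ?thesis
      unfolding G_def sum_atMost_split[OF j] using cf[OF j] by (simp add: u_def)
  qed
  have Gd: "G j d = \<kappa> * (m * p j - (T - p j))" if j: "j < d" for j
  proof -
    have "(\<Sum>k\<in>{..<d} - {j}. p k * coef d lam eps j k d) = (\<Sum>k\<in>{..<d} - {j}. - \<kappa> * p k)"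
      using j by (intro sum.cong) (auto simp: cf')
    also have "\<dots> = - \<kappa> * (T - p j)" using Tj[OF j] by (simp only: flip: sum_distrib_left)
    finally show ?thesis
      unfolding G_def sum_atMost_split[OF j] using cf[OF j] by (simp add: algebra_simps)
  qed
  have Gl: "G j l = \<kappa> * (\<mu> * (m - 1) * p j - u - 2 * \<mu> * (T - p j - p l)) - R * p l"
    if j: "j < d" and l: "l < d" "l \<noteq> j" for j l
  proof -
    have "(\<Sum>k\<in>{..<d} - {j} - {l}. p k * coef d lam eps j k l) = (\<Sum>k\<in>{..<d} - {j} - {l}. (- 2 * \<mu> * \<kappa>) * p k)"
      using j l by (intro sum.cong) (auto simp: cf'')
    also have "\<dots> = (- 2 * \<mu> * \<kappa>) * (T - p j - p l)"
      using Tjl[OF j l] by (simp only: flip: sum_distrib_left)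
    finally have *: "(\<Sum>k\<in>{..<d} - {j} - {l}. p k * coef d lam eps j k l) = (- 2 * \<mu> * \<kappa>) * (T - p j - p l)" .
    have **: "(\<Sum>k\<in>{..<d} - {j}. p k * coef d lam eps j k l) = p l * coef d lam eps j l l +
        (- 2 * \<mu> * \<kappa>) * (T - p j - p l)"
      using l unfolding *[symmetric] by (subst sum.remove[of _ l]) auto
    show ?thesis
      unfolding G_def sum_atMost_split[OF j] ** cf'[OF j l] by (simp add: u_def algebra_simps)
  qed
  \<comment> \<open>Removes the weights \<open>q l j\<close>: a bound for \<open>G j l\<close>
    survives a factor in the unit interval if the bound is nonnegative.\<close>
  have scale: "t * x \<le> y" if "0 \<le> t" "t \<le> 1" "x \<le> y" "0 \<le> y" for t x y :: real
    using that by (smt (verit) mult_left_le_one_le mult_nonneg_nonpos mult_nonneg_nonneg)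
  have bj: "q j j * G j j \<le> p j * m * R + u * m * \<kappa> + \<mu> * (m - 1) * \<kappa> * (T - p j)" if j: "j < d" for j
  proof (rule scale)
    have "0 \<le> (m - 1) * (T - p j)"
    \<comment> \<open>For \<open>d = 1\<close> the factor \<open>m - 1\<close> is negative, but then
      no index other than \<open>j\<close> is left and \<open>T - p j\<close> vanishes.\<close>
    proof (cases "1 \<le> m")
      case False
      then have "d = 1" using m by auto
      then have "m = 0" using m by simp
      then show ?thesis using Tj_bounds[OF j] by simp
    qed (use Tj_bounds[OF j] in simp)
    then have "0 \<le> \<mu> * \<kappa> * ((m - 1) * (T - p j))" using \<mu> \<kappa> by simp
    then show "0 \<le> p j * m * R + u * m * \<kappa> + \<mu> * (m - 1) * \<kappa> * (T - p j)"
      using p[of j] j m \<kappa> u by (simp add: mult_ac)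
  qed (use Gj[OF j] q[of j j] j in auto)
  have bd: "q d j * G j d \<le> \<kappa> * (m - (T - p j))" if j: "j < d" for j
  proof (rule scale)
    show "G j d \<le> \<kappa> * (m - (T - p j))"
      unfolding Gd[OF j] using \<kappa> m p[of j] j by (intro mult_left_mono) (auto intro: mult_left_le)
    show "0 \<le> \<kappa> * (m - (T - p j))" using \<kappa> Tj_bounds[OF j] by simp
  qed (use q[of d j] j in auto)
  have bl: "q l j * G j l \<le> \<kappa> * (1 - u + X j l)" if j: "j < d" and l: "l < d" "l \<noteq> j" for j l
  proof (rule scale)
    have pj: "0 \<le> p j" "p j \<le> 1" and pl: "0 \<le> p l" "p l \<le> 1" using p j l by auto
    have w: "0 \<le> \<mu> * (m - 1)" using \<mu> m1[OF j l] by simp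
    have X0: "0 \<le> X j l" using w pj pl by (auto simp: X_def)
    then show "0 \<le> \<kappa> * (1 - u + X j l)" using \<kappa> u by simp
    have rest: "0 \<le> T - p j - p l"
      unfolding Tjl[OF j l, symmetric] using p by (intro sum_nonneg) auto
    have "\<mu> * (m - 1) * p j - 2 * \<mu> * (T - p j - p l) - p l \<le> 1 + X j l"
    proof (cases "2 * T \<le> m + 1")
      case True
      have "0 \<le> \<mu> * (T - p j - p l)" using \<mu> rest by simp
      then show ?thesis using True pl by (simp add: X_def)
    next
      case False
      \<comment> \<open>As \<open>\<mu> < 1 / 2\<close>, the corrections
        \<open>2 * \<mu> * p j\<close> and \<open>2 * \<mu> * p l\<close> are covered by
        \<open>1\<close> and \<open>p l\<close>. It remains to bound
        \<open>\<mu> * (m - 1) * p j * p l\<close> by \<open>2 * \<mu> * T\<close>, for which a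
        large \<open>T\<close> suffices.\<close>
      have "\<mu> * (m - 1) * (p j * p l) \<le> \<mu> * (m - 1)"
        using w pj pl by (intro mult_left_le) (auto intro: mult_le_one)
      moreover have "\<mu> * (m + 1) \<le> \<mu> * (2 * T)" using False \<mu> by (intro mult_left_mono) auto
      moreover have "\<mu> * (2 * p j) \<le> 1 / 2 * 2" using \<mu> pj by (intro mult_mono) auto
      moreover have "\<mu> * (2 * p l) \<le> 1 * p l" using \<mu> pl by (simp flip: mult.assoc) (intro mult_left_le_one_le; simp)
      ultimately show ?thesis using False \<mu> by (simp add: X_def algebra_simps)
    qed
    then have "\<kappa> * (\<mu> * (m - 1) * p j - u - 2 * \<mu> * (T - p j - p l) - p l) \<le> \<kappa> * (1 - u + X j l)"
      using \<kappa> by (intro mult_left_mono) auto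
    moreover have "\<kappa> * p l \<le> R * p l" using \<kappa> pl by (intro mult_right_mono) auto
    ultimately show "G j l \<le> \<kappa> * (1 - u + X j l)"
      unfolding Gl[OF j l] by (simp add: algebra_simps)
  qed (use q[of l j] j l in auto)
  \<comment> \<open>\<open>Y j\<close> bounds the sum of \<open>X j l\<close> over \<open>l\<close>.
    In the second case \<open>p j\<close> is replaced by 1 and the sum of \<open>1 - p l\<close> is
    \<open>m - (T - p j)\<close>.\<close>
  define Y where "Y j = (if 2 * T \<le> m + 1 then \<mu> * (m - 1) * m * p j else \<mu> * (m - 1) * (m - (T - p j)))" for j
  have XY: "(\<Sum>l\<in>{..<d} - {j}. X j l) \<le> Y j" if j: "j < d" for j
  proof (cases "2 * T \<le> m + 1")
    case True
    then show ?thesis using cardO[OF j] by (simp add: X_def Y_def mult_ac)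
  next
    case False
    have "(\<Sum>l\<in>{..<d} - {j}. X j l) \<le> (\<Sum>l\<in>{..<d} - {j}. \<mu> * (m - 1) * (1 - p l))"
    proof (rule sum_mono)
      fix l assume "l \<in> {..<d} - {j}"
      then have "0 \<le> \<mu> * (m - 1)" "0 \<le> p j" "p j \<le> 1" "p l \<le> 1"
        using \<mu> m1[OF j, of l] p j by auto
      then have "p j * (\<mu> * (m - 1) * (1 - p l)) \<le> \<mu> * (m - 1) * (1 - p l)"
        by (intro mult_left_le_one_le mult_nonneg_nonneg[of "_ * _"]) auto
      then show "X j l \<le> \<mu> * (m - 1) * (1 - p l)" using False by (simp add: X_def mult_ac)
    qed
    also have "\<dots> = \<mu> * (m - 1) * (\<Sum>l\<in>{..<d} - {j}. 1 - p l)"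
      by (rule sum_distrib_left[symmetric])
    also have "\<dots> = Y j"
      using False Tj[OF j] cardO[OF j] by (simp add: Y_def sum_subtractf)
    finally show ?thesis .
  qed
  have bound: "(\<Sum>k\<le>d. \<Sum>l\<le>d. p k * q l j * coef d lam eps j k l) \<le>
     p j * m * R + u * m * \<kappa> + \<mu> * (m - 1) * \<kappa> * (T - p j) + \<kappa> * (m - (T - p j)) + \<kappa> * (m * (1 - u) + Y j)"
    if j: "j < d" for j
  proof -
    have "(\<Sum>k\<le>d. \<Sum>l\<le>d. p k * q l j * coef d lam eps j k l) = (\<Sum>l\<le>d. q l j * G j l)"
      unfolding G_def sum_distrib_left by (subst sum.swap) (simp add: mult_ac)
    also have "\<dots> = q d j * G j d + q j j * G j j + (\<Sum>l\<in>{..<d} - {j}. q l j * G j l)"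
      by (rule sum_atMost_split[OF j])
    also have "(\<Sum>l\<in>{..<d} - {j}. q l j * G j l) \<le> (\<Sum>l\<in>{..<d} - {j}. \<kappa> * (1 - u + X j l))"
      using bl[OF j] by (intro sum_mono) auto
    also have "\<dots> = \<kappa> * (m * (1 - u) + (\<Sum>l\<in>{..<d} - {j}. X j l))"
      using cardO[OF j] by (simp add: sum.distrib flip: sum_distrib_left)
    also have "\<dots> \<le> \<kappa> * (m * (1 - u) + Y j)"
      using XY[OF j] \<kappa> by simp
    finally show ?thesis using bj[OF j] bd[OF j] by simp
  qed
  have sp: "(\<Sum>j<d. T - p j) = m * T"
    using m by (simp add: sum_subtractf T_def[symmetric] algebra_simps)
  have Td: "0 \<le> (m + 1) - T"
  proof -
    have "T \<le> (\<Sum>k<d. 1)" unfolding T_def using p by (intro sum_mono) auto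
    then show ?thesis using m by simp
  qed
  \<comment> \<open>Both cases meet in the third deficit: for small \<open>T\<close> through
    \<open>T <= m + 1 - T\<close>, for large \<open>T\<close> with equality.\<close>
  have Ysum: "(\<Sum>j<d. Y j) \<le> \<mu> * (m - 1) * m * ((m + 1) - T)"
  proof (cases "2 * T \<le> m + 1")
    case True
    then have "(\<Sum>j<d. Y j) = \<mu> * (m - 1) * m * T"
      by (simp add: Y_def T_def flip: sum_distrib_left)
    also have "\<dots> \<le> \<mu> * (m - 1) * m * ((m + 1) - T)"
    proof (rule mult_left_mono)
      have "m = 0 \<or> 1 \<le> m" using d by (cases "d = 1") (auto simp: defs(5))
      then show "0 \<le> \<mu> * (m - 1) * m" using \<mu> by auto
    qed (use True in simp)
    finally show ?thesis .
  next
    case False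
    then have "(\<Sum>j<d. Y j) = \<mu> * (m - 1) * (\<Sum>j<d. m - (T - p j))"
      by (simp add: Y_def flip: sum_distrib_left)
    also have "(\<Sum>j<d. m - (T - p j)) = m * (m + 1) - m * T"
      using sp m by (simp add: sum_subtractf mult.commute)
    finally show ?thesis by (simp add: algebra_simps)
  qed
  have "(\<Sum>j<d. \<Sum>k\<le>d. \<Sum>l\<le>d. p k * q l j * coef d lam eps j k l) \<le>
    (\<Sum>j<d. p j * m * R + u * m * \<kappa> + \<mu> * (m - 1) * \<kappa> * (T - p j) + \<kappa> * (m - (T - p j)) + \<kappa> * (m * (1 - u) + Y j))"
    using bound by (intro sum_mono) auto
  also have "\<dots> = T * (m * R) + (m + 1) * (u * m * \<kappa>) + \<mu> * (m - 1) * \<kappa> * (m * T)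
      + \<kappa> * ((m + 1) * m - m * T) + \<kappa> * ((m + 1) * (m * (1 - u)) + (\<Sum>j<d. Y j))"
    unfolding sum.distrib mult.assoc sum_distrib_left[symmetric] sum_distrib_right[symmetric]
      sum_subtractf[of "\<lambda>_. m"] sp T_def[symmetric]
    using m by simp
  also have "\<dots> \<le> T * (m * R) + (m + 1) * (u * m * \<kappa>) + \<mu> * (m - 1) * \<kappa> * (m * T)
      + m * ((m + 1) - T) * R + \<kappa> * ((m + 1) * (m * (1 - u)) + \<mu> * (m - 1) * m * ((m + 1) - T))"
  proof -
    have "\<kappa> * ((m + 1) * m - m * T) = m * ((m + 1) - T) * \<kappa>" by (simp add: algebra_simps)
    also have "\<dots> \<le> m * ((m + 1) - T) * R"
      using m Td \<kappa> by (intro mult_left_mono mult_nonneg_nonneg) auto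
    finally have "\<kappa> * ((m + 1) * m - m * T) \<le> m * ((m + 1) - T) * R" .
    moreover have "\<kappa> * ((m + 1) * (m * (1 - u)) + (\<Sum>j<d. Y j)) \<le>
        \<kappa> * ((m + 1) * (m * (1 - u)) + \<mu> * (m - 1) * m * ((m + 1) - T))"
      using Ysum \<kappa> by (intro mult_left_mono) auto
    ultimately show ?thesis by linarith
  qed
  also have "\<dots> = (m + 1) * (m * R + m * \<kappa> + m * (\<mu> * (m - 1) * \<kappa>))"
    by (simp add: algebra_simps)
  also have "\<dots> = (\<Sum>j<d. m * R + m * \<kappa> + m * (\<mu> * (m - 1) * \<kappa>))"
    using m by simp
  also have "\<dots> = (\<Sum>j<d. \<Sum>k\<le>d. coef d lam eps j k j)"
  proof (rule sum.cong[OF refl])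
    fix j assume "j \<in> {..<d}"
    then have j: "j < d" by simp
    have "(\<Sum>k\<in>{..<d} - {j}. coef d lam eps j k j) = (\<Sum>k\<in>{..<d} - {j}. \<mu> * (m - 1) * \<kappa>)"
      using j by (intro sum.cong) (auto simp: cf')
    also have "\<dots> = m * (\<mu> * (m - 1) * \<kappa>)" using cardO[OF j] by simp
    finally show "m * R + m * \<kappa> + m * (\<mu> * (m - 1) * \<kappa>) = (\<Sum>k\<le>d. coef d lam eps j k j)"
      unfolding sum_atMost_split[OF j] using cf[OF j] by simp
  qed
  finally show ?thesis .
qed

section \<open>The three regimes\<close>

theorem theorem3p2:
  fixes d N :: nat and lam eps :: real
  assumes "d \<ge> 1" and "N \<ge> 1" and "0 < lam" and "lam < 1" and "eps \<ge> 0"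
  shows "(eps \<le> lam * (lam * (real d - 2) + 4) / (2 * (lam * (real d - 1) + 2))
            \<longrightarrow> is_global_minimizer d N lam eps (P_std d) (Q_std d))
       \<and> (eps = (1 + (real d - 1) * (lam / 2)) / real d
            \<longrightarrow> is_global_minimizer d N lam eps (P_adv d) (Q_adv d))
       \<and> (eps \<ge> lam / 2 + 3 / 2 * ((2 - lam) / ((real d - 1) * lam ^ 2 + 3))
            \<longrightarrow> is_global_minimizer d N lam eps (0\<^sub>m (d+1) (d+1)) (0\<^sub>m (d+1) (d+1)))"
proof (intro conjI impI)
  let ?V = "\<lambda>P Q. \<Sum>j<d. \<Sum>k\<le>d. \<Sum>l\<le>d. P $$ (d, k) * Q $$ (l, j) * coef d lam eps j k l"
  \<comment> \<open>The risk is \<open>?V\<close> times the negative constant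
    \<open>- (1 / real d)\<close>, so minimizers of the risk are maximizers of
    \<open>?V\<close>.\<close>
  have minI: "is_global_minimizer d N lam eps P Q"
    if adm: "admissible d P" "admissible d Q"
      and le: "\<And>P' Q'. admissible d P' \<Longrightarrow> admissible d Q' \<Longrightarrow> ?V P' Q' \<le> ?V P Q" for P Q
    unfolding is_global_minimizer_def using adm le assms
    by (auto simp: adv_risk_eq divide_right_mono)
  show "is_global_minimizer d N lam eps (P_std d) (Q_std d)"
    if "eps \<le> lam * (lam * (real d - 2) + 4) / (2 * (lam * (real d - 1) + 2))"
  proof (rule minI)
    show "admissible d (P_std d)" "admissible d (Q_std d)"
      by (auto simp: admissible_def P_std_def Q_std_def)
    fix P Q assume adm: "admissible d P" "admissible d Q"
    have "?V P Q \<le> (\<Sum>j<d. \<Sum>k\<le>d. \<Sum>l\<le>d. coef d lam eps j k l)"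
      using adm that assms by (intro sum_mono coef_le_std) (auto simp: admissible_def)
    also have "\<dots> = ?V (P_std d) (Q_std d)"
      by (auto simp: P_std_def Q_std_def intro!: sum.cong)
    finally show "?V P Q \<le> ?V (P_std d) (Q_std d)" .
  qed
  show "is_global_minimizer d N lam eps (P_adv d) (Q_adv d)"
    if "eps = (1 + (real d - 1) * (lam / 2)) / real d"
  proof (rule minI)
    show "admissible d (P_adv d)" "admissible d (Q_adv d)"
      by (auto simp: admissible_def P_adv_def Q_adv_def)
    fix P Q assume adm: "admissible d P" "admissible d Q"
    have "?V P Q \<le> (\<Sum>j<d. \<Sum>k\<le>d. coef d lam eps j k j)"
      using adm that assms by (intro coef_le_adv) (auto simp: admissible_def)
    also have "\<dots> = (\<Sum>j<d. \<Sum>k\<le>d. \<Sum>l\<le>d. if l = j then coef d lam eps j k l else 0)"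
      by (auto intro!: sum.cong)
    also have "\<dots> = ?V (P_adv d) (Q_adv d)"
      by (intro sum.cong refl) (auto simp: P_adv_def Q_adv_def)
    finally show "?V P Q \<le> ?V (P_adv d) (Q_adv d)" .
  qed
  show "is_global_minimizer d N lam eps (0\<^sub>m (d+1) (d+1)) (0\<^sub>m (d+1) (d+1))"
    if "eps \<ge> lam / 2 + 3 / 2 * ((2 - lam) / ((real d - 1) * lam ^ 2 + 3))"
  proof (rule minI)
    show "admissible d (0\<^sub>m (d+1) (d+1))" "admissible d (0\<^sub>m (d+1) (d+1))"
      by (auto simp: admissible_def)
    fix P Q assume adm: "admissible d P" "admissible d Q"
    have "?V P Q \<le> 0"
      using adm that assms
      by (intro sum_nonpos mult_nonneg_nonpos coef_nonpos) (auto simp: admissible_def)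
    then show "?V P Q \<le> ?V (0\<^sub>m (d+1) (d+1)) (0\<^sub>m (d+1) (d+1))" by simp
  qed
qed

end
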